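(* Let $\Delta = d+1\ge 3$ be an integer and $\delta\in(0,1)$, and let $\lambda=(1-\delta)\lambda_c(\Delta)$ with $\lambda_c(\Delta)=\frac{(\Delta-1)^{\Delta-1}}{(\Delta-2)^{\Delta}}$. For $h\ge1$, let $T_{\Delta,h}$ be the rooted $\Delta$-regular tree truncated at depth $h$, and let $C_{\Delta,h,\lambda}$ be the optimal (smallest) $\ell_\infty$-spectral independence constant of the hardcore Gibbs distribution $\mu_{T_{\Delta,h},\lambda}$. Then $$\lim_{h\to\infty} C_{\Delta,h,\lambda} = \frac{1+\hat x}{1-d\hat x},$$ where $\hat x$ is the unique fixed point in $[0,1]$ of $F_{d,\lambda}(x)=\frac{\lambda(1-x)^d}{1+\lambda(1-x)^d}$.
   Context: $T_{\Delta,h}$ is the tree in which the root has $\Delta$ children, every non-root vertex at depth less than $h$ has $\Delta-1$ children, and all leaves are at depth $h$. The hardcore model on a graph $G$ with fugacity $\lambda>0$ is the distribution $\mu_{G,\lambda}(\sigma)\propto\lambda^{|\sigma|}$ over independent sets $\sigma$ of $G$, viewed as a distribution over $\{0,1\}^V$. For a distribution $\mu$ over $\{0,1\}^n$, let $A_\mu$ be the set of coordinates $i$ with $\Pr_\mu[\sigma_i=0]>0$ and $\Pr_\mu[\sigma_i=1]>0$; for $i,j\in A_\mu$ the influence is $\Psi_\mu(i,j)=\Pr_\mu[\sigma_j=1\mid\sigma_i=1]-\Pr_\mu[\sigma_j=1\mid\sigma_i=0]$. A pinning is a partial configuration $\tau\in\{0,1\}^\Lambda$ with $\Pr_\mu[\sigma_\Lambda=\tau]>0$,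 and $\mu^\tau$ is the conditional distribution. $\mu$ satisfies $\ell_\infty$-spectral independence with constant $C$ if for every pinning $\tau$, $\max_{i\in A_{\mu^\tau}}\sum_{j\in A_{\mu^\tau}}|\Psi_{\mu^\tau}(i,j)|\le C$; the optimal constant is the supremum over pinnings $\tau$ of this maximum. *)

theory Defs
  imports "HOL-Probability.Probability"
begin

section \<open>The hardcore model\<close>

text \<open>A finite simple graph is given by its vertex set \<open>V\<close> and its set \<open>E\<close> of two-element edges.\<close>

definition indep_sets_of :: "'v set \<Rightarrow> 'v set set \<Rightarrow> 'v set set" where
  "indep_sets_of V E = {S. S \<subseteq> V \<and> (\<forall>e\<in>E. \<not> e \<subseteq> S)}"

definition hardcore_Z :: "'v set \<Rightarrow> 'v set set \<Rightarrow> real \<Rightarrow> real" where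
  "hardcore_Z V E lam = (\<Sum>S\<in>indep_sets_of V E. lam ^ card S)"

definition hardcore_set_pmf :: "'v set \<Rightarrow> 'v set set \<Rightarrow> real \<Rightarrow> 'v set pmf" where
  "hardcore_set_pmf V E lam =
     embed_pmf (\<lambda>S. if S \<in> indep_sets_of V E then lam ^ card S / hardcore_Z V E lam else 0)"

text \<open>The same distribution on configurations; \<open>True\<close> encodes 1, and coordinates outside
  \<open>V\<close> are constantly \<open>False\<close>.\<close>

definition hardcore :: "'v set \<Rightarrow> 'v set set \<Rightarrow> real \<Rightarrow> ('v \<Rightarrow> bool) pmf" where
  "hardcore V E lam = map_pmf (\<lambda>S v. v \<in> S) (hardcore_set_pmf V E lam)"

lemma finite_indep_sets_of: "finite V \<Longrightarrow> finite (indep_sets_of V E)"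
  by (rule finite_subset[of _ "Pow V"]) (auto simp: indep_sets_of_def)

lemma hardcore_Z_pos:
  assumes "finite V" "{} \<notin> E" "lam > 0"
  shows "hardcore_Z V E lam > 0"
  unfolding hardcore_Z_def
proof (rule sum_pos2[where i = "{}"])
  show "{} \<in> indep_sets_of V E"
    using assms by (auto simp: indep_sets_of_def)
qed (use assms finite_indep_sets_of in auto)

lemma pmf_hardcore_set_pmf:
  assumes "finite V" "{} \<notin> E" "lam > 0"
  shows "pmf (hardcore_set_pmf V E lam) S =
    (if S \<in> indep_sets_of V E then lam ^ card S / hardcore_Z V E lam else 0)"
  unfolding hardcore_set_pmf_def
proof (rule pmf_embed_pmf)
  let ?I = "indep_sets_of V E" and ?Z = "hardcore_Z V E lam"
  let ?f = "\<lambda>S. if S \<in> ?I then lam ^ card S / ?Z else 0"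
  have Z: "?Z > 0" by (rule hardcore_Z_pos[OF assms])
  show nonneg: "0 \<le> ?f S" for S using Z assms by auto
  have fin: "finite ?I" using assms(1) by (rule finite_indep_sets_of)
  have "(\<integral>\<^sup>+ S. ennreal (?f S) \<partial>count_space UNIV) = (\<Sum>S\<in>?I. ennreal (?f S))"
    by (rule nn_integral_count_space'[OF fin]) auto
  also have "\<dots> = ennreal (\<Sum>S\<in>?I. ?f S)"
    by (rule sum_ennreal) (rule nonneg)
  also have "(\<Sum>S\<in>?I. ?f S) = (\<Sum>S\<in>?I. lam ^ card S) / ?Z"
    by (simp add: sum_divide_distrib)
  also have "\<dots> = 1" using Z by (simp add: hardcore_Z_def)
  finally show "(\<integral>\<^sup>+ S. ennreal (?f S) \<partial>count_space UNIV) = 1" by simp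
qed


section \<open>Spectral independence in the infinity norm\<close>

text \<open>Throughout, \<open>V\<close> is the finite set of coordinates of the distribution \<open>\<mu>\<close>.\<close>

definition active :: "'i set \<Rightarrow> ('i \<Rightarrow> bool) pmf \<Rightarrow> 'i set" where
  "active V \<mu> = {i \<in> V. \<P>(\<sigma> in measure_pmf \<mu>. \<not> \<sigma> i) > 0 \<and> \<P>(\<sigma> in measure_pmf \<mu>. \<sigma> i) > 0}"

definition influence :: "('i \<Rightarrow> bool) pmf \<Rightarrow> 'i \<Rightarrow> 'i \<Rightarrow> real" where
  "influence \<mu> i j =
     \<P>(\<sigma> in measure_pmf \<mu>. \<sigma> j \<bar> \<sigma> i) - \<P>(\<sigma> in measure_pmf \<mu>. \<sigma> j \<bar> \<not> \<sigma> i)"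

text \<open>A partial configuration on \<open>\<Lambda>\<close> is a total function \<open>\<tau>\<close> whose values outside \<open>\<Lambda>\<close> are ignored.\<close>

definition agrees :: "'i set \<Rightarrow> ('i \<Rightarrow> bool) \<Rightarrow> ('i \<Rightarrow> bool) set" where
  "agrees \<Lambda> \<tau> = {\<sigma>. \<forall>i\<in>\<Lambda>. \<sigma> i = \<tau> i}"

definition pinning :: "'i set \<Rightarrow> ('i \<Rightarrow> bool) pmf \<Rightarrow> 'i set \<Rightarrow> ('i \<Rightarrow> bool) \<Rightarrow> bool" where
  "pinning V \<mu> \<Lambda> \<tau> \<longleftrightarrow> \<Lambda> \<subseteq> V \<and> measure_pmf.prob \<mu> (agrees \<Lambda> \<tau>) > 0"

definition pinned :: "('i \<Rightarrow> bool) pmf \<Rightarrow> 'i set \<Rightarrow> ('i \<Rightarrow> bool) \<Rightarrow> ('i \<Rightarrow> bool) pmf" where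
  "pinned \<mu> \<Lambda> \<tau> = cond_pmf \<mu> (agrees \<Lambda> \<tau>)"

text \<open>If no coordinate is active (e.g. everything is pinned), the maximum is over the empty set
  and is taken to be 0.\<close>

definition max_influence :: "'i set \<Rightarrow> ('i \<Rightarrow> bool) pmf \<Rightarrow> real" where
  "max_influence V \<mu> =
     (if active V \<mu> = {} then 0
      else (MAX i\<in>active V \<mu>. \<Sum>j\<in>active V \<mu>. \<bar>influence \<mu> i j\<bar>))"

definition linf_spectrally_independent :: "'i set \<Rightarrow> ('i \<Rightarrow> bool) pmf \<Rightarrow> real \<Rightarrow> bool" where
  "linf_spectrally_independent V \<mu> C \<longleftrightarrow>
     (\<forall>\<Lambda> \<tau>. pinning V \<mu> \<Lambda> \<tau> \<longrightarrow> max_influence V (pinned \<mu> \<Lambda> \<tau>) \<le> C)"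

definition linf_SI_constant :: "'i set \<Rightarrow> ('i \<Rightarrow> bool) pmf \<Rightarrow> real" where
  "linf_SI_constant V \<mu> =
     (SUP (\<Lambda>, \<tau>) \<in> {(\<Lambda>, \<tau>). pinning V \<mu> \<Lambda> \<tau>}. max_influence V (pinned \<mu> \<Lambda> \<tau>))"

lemma abs_influence_le_1: "\<bar>influence \<mu> i j\<bar> \<le> 1"
proof -
  have "0 \<le> cond_prob (measure_pmf \<mu>) P Q \<and> cond_prob (measure_pmf \<mu>) P Q \<le> 1" for P Q
    by (auto simp: cond_prob_def divide_le_eq_1 less_le
        intro!: measure_pmf.finite_measure_mono)
  from this[of "\<lambda>\<sigma>. \<sigma> j" "\<lambda>\<sigma>. \<sigma> i"] this[of "\<lambda>\<sigma>. \<sigma> j" "\<lambda>\<sigma>. \<not> \<sigma> i"]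
  show ?thesis by (auto simp: influence_def abs_le_iff)
qed

lemma max_influence_le_card:
  assumes "finite V"
  shows "max_influence V \<mu> \<le> card V"
proof -
  have fin: "finite (active V \<mu>)" and sub: "active V \<mu> \<subseteq> V"
    using assms by (auto simp: active_def)
  have "(\<Sum>j\<in>active V \<mu>. \<bar>influence \<mu> i j\<bar>) \<le> card V" for i
  proof -
    have "(\<Sum>j\<in>active V \<mu>. \<bar>influence \<mu> i j\<bar>) \<le> (\<Sum>j\<in>active V \<mu>. 1)"
      by (intro sum_mono abs_influence_le_1)
    also have "\<dots> \<le> card V"
      using card_mono[OF assms sub] by simp
    finally show ?thesis .
  qed
  then show ?thesis using fin by (auto simp: max_influence_def)
qed

text \<open>The supremum is indeed the smallest admissible constant.\<close>

lemma linf_spectrally_independent_iff: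
  assumes "finite V"
  shows "linf_spectrally_independent V \<mu> C \<longleftrightarrow> linf_SI_constant V \<mu> \<le> C"
proof -
  let ?P = "{(\<Lambda>, \<tau>). pinning V \<mu> \<Lambda> \<tau>}"
  let ?f = "\<lambda>(\<Lambda>, \<tau>). max_influence V (pinned \<mu> \<Lambda> \<tau>)"
  have "({}, \<lambda>_. False) \<in> ?P"
    by (auto simp: pinning_def agrees_def)
  then have ne: "?P \<noteq> {}" by blast
  have bdd: "bdd_above (?f ` ?P)"
    by (rule bdd_aboveI[where M = "real (card V)"]) (auto simp: max_influence_le_card[OF assms])
  show ?thesis
    unfolding linf_SI_constant_def cSUP_le_iff[OF ne bdd]
    by (auto simp: linf_spectrally_independent_def)
qed


section \<open>Truncated regular trees\<close>

text \<open>A vertex is the list of child indices on the path from the root \<open>[]\<close>; its depth is its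
  length.\<close>

definition tree_verts :: "nat \<Rightarrow> nat \<Rightarrow> nat list set" where
  "tree_verts \<Delta> h =
     {w. length w \<le> h \<and> (\<forall>k<length w. w ! k < (if k = 0 then \<Delta> else \<Delta> - 1))}"

definition tree_edges :: "nat \<Rightarrow> nat \<Rightarrow> nat list set set" where
  "tree_edges \<Delta> h = {{w, w @ [c]} | w c. w @ [c] \<in> tree_verts \<Delta> h}"

lemma finite_tree_verts: "finite (tree_verts \<Delta> h)"
proof (rule finite_subset)
  show "tree_verts \<Delta> h \<subseteq> {w. set w \<subseteq> {..<\<Delta>} \<and> length w \<le> h}"
    by (fastforce simp: tree_verts_def in_set_conv_nth split: if_splits)
qed (simp add: finite_lists_length_le)

definition lambda_c :: "nat \<Rightarrow> real" where
  "lambda_c \<Delta> = (real \<Delta> - 1) ^ (\<Delta> - 1) / (real \<Delta> - 2) ^ \<Delta>"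

definition hardcore_F :: "nat \<Rightarrow> real \<Rightarrow> real \<Rightarrow> real" where
  "hardcore_F d lam x = lam * (1 - x) ^ d / (1 + lam * (1 - x) ^ d)"

end

theory Submission
  imports Defs
begin

text \<open>
  Deleting the neighbours of a vertex \<open>v\<close> one at a time expresses the marginal \<open>x\<close> of \<open>v\<close> through marginals
  \<open>x\<^sub>u\<close> of its neighbours in smaller induced subgraphs, \<open>x = \<rho> / (1 + \<rho>)\<close> with \<open>\<rho> = \<lambda> \<Prod>\<^sub>u (1 - x\<^sub>u)\<close>, and
  bounds the total influence by \<open>T \<le> 1 + \<Sum>\<^sub>u x\<^sub>u T\<^sub>u\<close>. With \<open>K = 1 / (1 - d x\<^sub>*)\<close>, where \<open>x\<^sub>*\<close> is the fixed
  point, the bounds \<open>T \<le> K\<close> and \<open>x T \<le> K x\<^sub>*\<close> propagate through this recursion: the first is immediate, the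
  second is AM-GM. Hence every graph of maximal degree \<open>d + 1\<close> has constant at most \<open>1 + (d + 1) K x\<^sub>*\<close>,
  and pinnings only pass to induced subgraphs. On the tree without pinnings the recursion for the sum of influences of the root
  weighted with alternating signs is exact, and its marginals are iterates of \<open>F\<close>, which converge to \<open>x\<^sub>*\<close>
  because \<open>F\<close> is a contraction in the variable \<open>artanh (sqrt x)\<close>.
\<close>

section \<open>The recursion below the critical fugacity\<close>

text \<open>Applies \<open>y \<le> exp (y - 1)\<close> to every factor. This yields AM-GM without
  roots: nonnegative numbers of mean 1 have product at most 1.\<close>

lemma prod_le_exp_sum:
  fixes f :: "'a \<Rightarrow> real"
  assumes "\<And>i. i \<in> I \<Longrightarrow> 0 \<le> f i"
  shows "prod f I \<le> exp (\<Sum>i\<in>I. f i - 1)"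
proof (cases "finite I")
  case True
  have "prod f I \<le> (\<Prod>i\<in>I. exp (f i - 1))"
    using assms exp_ge_add_one_self[of "f _ - 1"] by (intro prod_mono) auto
  then show ?thesis using True by (simp add: exp_sum)
qed simp

text \<open>This is AM-GM for the \<open>d + 1\<close> numbers \<open>1 - x i\<close> (\<open>i \<in> I\<close>), \<open>1\<close> (repeated \<open>d - card I\<close> times) and
  the last factor, whose mean is \<open>w\<close>.\<close>

lemma prod_times_deficit_le_power:
  fixes x :: "'a \<Rightarrow> real"
  assumes I: "finite I" "card I \<le> d" and x: "\<And>i. i \<in> I \<Longrightarrow> x i \<le> 1" and w: "0 < w"
  shows "(\<Prod>i\<in>I. 1 - x i) * (w - real d * (1 - w) + (\<Sum>i\<in>I. x i)) \<le> w ^ Suc d"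
proof -
  let ?P = "\<Prod>i\<in>I. 1 - x i" and ?s = "\<Sum>i\<in>I. x i"
  define t where "t = w - real d * (1 - w) + ?s"
  have P0: "0 \<le> ?P" using x by (intro prod_nonneg) auto
  show ?thesis
  proof (cases "t \<le> 0")
    case True
    then have "?P * t \<le> 0" using P0 by (simp add: mult_nonneg_nonpos)
    also have "0 \<le> w ^ Suc d" using w by simp
    finally show ?thesis by (simp add: t_def)
  next
    case False
    have "(\<Prod>i\<in>I. (1 - x i) / w) \<le> exp (\<Sum>i\<in>I. (1 - x i) / w - 1)"
      using x w by (intro prod_le_exp_sum) (auto intro!: divide_nonneg_pos)
    moreover have "(\<Sum>i\<in>I. (1 - x i) / w - 1) = (real (card I) * (1 - w) - ?s) / w"
      using w by (simp add: sum_subtractf sum_divide_distrib[symmetric] diff_divide_distrib right_diff_distrib)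
    moreover have "(\<Prod>i\<in>I. (1 - x i) / w) = ?P / w ^ card I"
      by (simp add: prod_dividef)
    ultimately have 1: "?P / w ^ card I \<le> exp ((real (card I) * (1 - w) - ?s) / w)" by simp
    have "1 / w \<le> exp (1 / w - 1)"
      using exp_ge_add_one_self[of "1 / w - 1"] by simp
    then have "(1 / w) ^ (d - card I) \<le> exp (1 / w - 1) ^ (d - card I)"
      using w by (intro power_mono) auto
    then have 2: "(1 / w) ^ (d - card I) \<le> exp (real (d - card I) * (1 / w - 1))"
      by (simp only: exp_of_nat_mult)
    have 3: "t / w \<le> exp (t / w - 1)"
      using exp_ge_add_one_self[of "t / w - 1"] by simp
    \<comment> \<open>After division by \<open>w\<close> the \<open>d + 1\<close> numbers have mean
      1, so the three exponents add up to 0.\<close>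
    have "?P / w ^ card I * (1 / w) ^ (d - card I) * (t / w) \<le>
        exp ((real (card I) * (1 - w) - ?s) / w) * exp (real (d - card I) * (1 / w - 1)) * exp (t / w - 1)"
      using 1 2 3 False w P0 by (intro mult_mono) auto
    also have "\<dots> = exp ((real (card I) * (1 - w) - ?s) / w + real (d - card I) * (1 / w - 1) + (t / w - 1))"
      by (simp add: exp_add)
    also have "(real (card I) * (1 - w) - ?s) / w + real (d - card I) * (1 / w - 1) + (t / w - 1) = 0"
      using w I(2) by (simp add: t_def of_nat_diff field_simps)
    finally have *: "?P / w ^ card I * (1 / w) ^ (d - card I) * (t / w) \<le> 1" by simp
    have "w ^ card I * w ^ (d - card I) = w ^ d"
      using I(2) by (simp flip: power_add)
    then have "?P / w ^ card I * (1 / w) ^ (d - card I) * (t / w) = ?P * t / w ^ Suc d"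
      by (simp add: power_one_over field_simps)
    with * w have "?P * t \<le> w ^ Suc d"
      by (simp only: divide_le_eq_1_pos zero_less_power)
    then show ?thesis by (simp add: t_def)
  qed
qed

text \<open>Only the positive denominator is cleared. In the new form the right-hand side is
  antitone in \<open>x\<close> and contains the power that AM-GM produces.\<close>

lemma hardcore_F_eq_iff:
  assumes "0 < lam" "x \<le> 1"
  shows "hardcore_F d lam x = x \<longleftrightarrow> x = lam * (1 - x) ^ Suc d"
proof -
  have "0 < 1 + lam * (1 - x) ^ d" using assms by (intro add_pos_nonneg) auto
  then have "hardcore_F d lam x = x \<longleftrightarrow> lam * (1 - x) ^ d = x * (1 + lam * (1 - x) ^ d)"
    by (simp add: hardcore_F_def field_simps)
  then show ?thesis by (simp add: algebra_simps) linarith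
qed

text \<open>The identity increases strictly while \<open>lam * (1 - x) ^ Suc d\<close> does not
  increase on \<open>x \<le> 1\<close>, so fixed points \<open>a < b\<close> cannot coexist.\<close>

lemma hardcore_F_fixed_point_unique:
  assumes "0 < lam" "x \<le> 1" "y \<le> 1" "hardcore_F d lam x = x" "hardcore_F d lam y = y"
  shows "x = y"
proof -
  have *: "\<not> a < b" if "a \<le> 1" "b \<le> 1" "hardcore_F d lam a = a" "hardcore_F d lam b = b" for a b
  proof
    assume "a < b"
    then have "lam * (1 - b) ^ Suc d \<le> lam * (1 - a) ^ Suc d"
      using that assms(1) by (intro mult_left_mono power_mono) auto
    with that \<open>a < b\<close> show False using hardcore_F_eq_iff[OF assms(1)] by fastforce
  qed
  show ?thesis using *[of x y] *[of y x] assms by force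
qed

text \<open>The step that propagates the bound on marginal times total influence. AM-GM with
  \<open>w = 1 - xh\<close> gives the bound \<open>(1 - xh) ^ Suc d\<close>, which
  \<open>lam\<close> turns into \<open>xh\<close> by the fixed-point equation.\<close>

lemma sum_recursion_bound:
  fixes x :: "'a \<Rightarrow> real"
  assumes I: "finite I" "card I \<le> d" and x: "\<And>i. i \<in> I \<Longrightarrow> x i \<le> 1"
    and lam: "0 < lam" and xh: "xh < 1" "real d * xh < 1" "hardcore_F d lam xh = xh"
  defines "P \<equiv> lam * (\<Prod>i\<in>I. 1 - x i)"
  shows "P / (1 + P) * (1 + (\<Sum>i\<in>I. x i) / (1 - real d * xh)) \<le> xh / (1 - real d * xh)"
proof -
  let ?s = "\<Sum>i\<in>I. x i"
  have P0: "0 \<le> P" using x lam by (auto simp: P_def intro!: mult_nonneg_nonneg prod_nonneg)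
  have "(\<Prod>i\<in>I. 1 - x i) * ((1 - xh) - real d * (1 - (1 - xh)) + ?s) \<le> (1 - xh) ^ Suc d"
    using I x xh by (intro prod_times_deficit_le_power) auto
  then have "lam * ((\<Prod>i\<in>I. 1 - x i) * ((1 - xh) - real d * (1 - (1 - xh)) + ?s)) \<le> lam * (1 - xh) ^ Suc d"
    using lam by (intro mult_left_mono) auto
  also have "\<dots> = xh" using hardcore_F_eq_iff[of lam xh d] lam xh by simp
  \<comment> \<open>Moving the term \<open>P * xh\<close> to the right produces the denominator
    \<open>1 + P\<close> of the marginal.\<close>
  finally have "P * (1 - real d * xh + ?s) \<le> xh * (1 + P)"
    by (simp add: P_def algebra_simps)
  then have *: "P / (1 + P) * (1 - real d * xh + ?s) \<le> xh"
    using P0 by (simp add: divide_le_eq)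
  have "P / (1 + P) * (1 + ?s / (1 - real d * xh)) = P / (1 + P) * (1 - real d * xh + ?s) / (1 - real d * xh)"
    using xh(2) by (simp add: add_divide_distrib flip: times_divide_eq_right)
  also have "\<dots> \<le> xh / (1 - real d * xh)"
    using * xh(2) by (intro divide_right_mono) auto
  finally show ?thesis .
qed

section \<open>Convergence of the iterates of \<open>hardcore_F\<close>\<close>

lemma lambda_c_Suc: "lambda_c (Suc d) = real d ^ d / (real d - 1) ^ Suc d"
  by (simp add: lambda_c_def algebra_simps)

lemma lambda_c_pos: "2 \<le> d \<Longrightarrow> 0 < lambda_c (Suc d)"
  by (simp add: lambda_c_Suc)

text \<open>AM-GM for \<open>d\<close> equal numbers \<open>1 - x\<close>, where \<open>w\<close> is
  their value at the critical fixed point \<open>x = 1 / d\<close>. Equality holds there, which is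
  how the critical fugacity enters.\<close>

lemma power_times_linear_le_lambda_c:
  assumes "2 \<le> d" "x \<le> 1"
  shows "(1 - x) ^ d * (real d ^ 2 * x - 1) \<le> 1 / lambda_c (Suc d)"
proof -
  define w where "w = (real d - 1) / real d"
  have w: "0 < w" using assms by (simp add: w_def)
  have *: "(1 - x) ^ d * (w - real d * (1 - w) + real d * x) \<le> w ^ Suc d"
    using prod_times_deficit_le_power[of "{..<d}" d "\<lambda>_. x" w] assms w by simp
  have "w - real d * (1 - w) + real d * x = (real d ^ 2 * x - 1) / real d"
    using assms by (simp add: w_def field_simps power2_eq_square)
  with * have "(1 - x) ^ d * (real d ^ 2 * x - 1) / real d \<le> w ^ Suc d" by simp
  then have "(1 - x) ^ d * (real d ^ 2 * x - 1) \<le> w ^ Suc d * real d"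
    using assms by (simp only: pos_divide_le_eq of_nat_0_less_iff)
  also have "\<dots> = 1 / lambda_c (Suc d)"
    using assms by (simp add: w_def lambda_c_Suc power_divide)
  finally show ?thesis .
qed

text \<open>The left-hand side is the squared slope of the conjugated map introduced below; the
  factor \<open>1 - \<delta>\<close> in \<open>lam\<close> keeps it away from 1. The bound
  \<open>1 + \<rho> - \<delta>\<close> is divided by \<open>1 + \<rho>\<close>, and
  \<open>\<rho> \<le> lam\<close> makes it uniform in \<open>x\<close>.\<close>

lemma hardcore_F_times_arg_le:
  assumes d: "2 \<le> d" and \<delta>: "0 < \<delta>" "\<delta> < 1" and lam: "lam = (1 - \<delta>) * lambda_c (Suc d)"
    and x: "0 \<le> x" "x \<le> 1"
  shows "real d ^ 2 * x * hardcore_F d lam x \<le> 1 - \<delta> / (1 + lam)"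
proof -
  define \<rho> where "\<rho> = lam * (1 - x) ^ d"
  have lam0: "0 < lam" using lam \<delta> lambda_c_pos[OF d] by simp
  have "(1 - x) ^ d \<le> 1" using x by (intro power_le_one) auto
  then have \<rho>: "0 \<le> \<rho>" "\<rho> \<le> lam" using lam0 x by (auto simp: \<rho>_def mult_left_le)
  have "lam * ((1 - x) ^ d * (real d ^ 2 * x - 1)) \<le> lam * (1 / lambda_c (Suc d))"
    using lam0 power_times_linear_le_lambda_c[OF d x(2)] by (intro mult_left_mono) auto
  also have "\<dots> = 1 - \<delta>" using lam lambda_c_pos[OF d] by simp
  finally have "real d ^ 2 * x * \<rho> \<le> (1 + \<rho>) - \<delta>" by (simp add: \<rho>_def algebra_simps)
  then have "real d ^ 2 * x * \<rho> / (1 + \<rho>) \<le> ((1 + \<rho>) - \<delta>) / (1 + \<rho>)"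
    using \<rho> by (intro divide_right_mono) auto
  also have "\<dots> = 1 - \<delta> / (1 + \<rho>)" using \<rho> by (simp add: diff_divide_distrib)
  also have "\<dots> \<le> 1 - \<delta> / (1 + lam)" using \<rho> \<delta> by (simp add: frac_le)
  finally show ?thesis by (simp add: hardcore_F_def \<rho>_def)
qed

text \<open>The substitution \<open>x = tanh\<^sup>2 \<theta>\<close> turns \<open>hardcore_F\<close> into a contraction: the derivative at \<open>\<theta>\<close> of
  the conjugated map is \<open>- d tanh \<theta> tanh \<theta>'\<close>, where \<open>\<theta>'\<close> is the image of \<open>\<theta>\<close>.\<close>

definition hardcore_angle :: "nat \<Rightarrow> real \<Rightarrow> real \<Rightarrow> real" where
  "hardcore_angle d lam \<theta> = arsinh (sqrt lam / cosh \<theta> ^ d)"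

text \<open>For \<open>x = tanh \<theta> ^ 2\<close> one has
  \<open>1 - x = 1 / cosh \<theta> ^ 2\<close>, and the odds \<open>x / (1 - x)\<close> are
  \<open>sinh \<theta> ^ 2\<close>. The new odds \<open>lam * (1 - x) ^ d\<close> are thus a squared
  \<open>sinh\<close>, which the \<open>arsinh\<close> in the definition inverts.\<close>

lemma tanh_sq_hardcore_angle:
  assumes "0 \<le> lam"
  shows "tanh (hardcore_angle d lam \<theta>) ^ 2 = hardcore_F d lam (tanh \<theta> ^ 2)"
proof -
  have *: "1 - tanh \<theta> ^ 2 = 1 / cosh \<theta> ^ 2"
    by (simp add: tanh_def power_divide sinh_square_eq diff_divide_distrib)
  have "sinh (hardcore_angle d lam \<theta>) ^ 2 = lam * (1 - tanh \<theta> ^ 2) ^ d"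
    unfolding * using assms
    by (simp add: hardcore_angle_def power_divide power_one_over flip: power_mult)
       (simp add: mult.commute)
  then show ?thesis
    by (simp add: hardcore_F_def tanh_def[of "hardcore_angle d lam \<theta>"] power_divide cosh_square_eq add.commute)
qed

lemma hardcore_angle_has_derivative:
  "(hardcore_angle d lam has_field_derivative
      - real d * tanh \<theta> * tanh (hardcore_angle d lam \<theta>)) (at \<theta> within A)"
proof -
  let ?s = "sqrt lam / cosh \<theta> ^ d"
  have c: "cosh (hardcore_angle d lam \<theta>) = sqrt (?s ^ 2 + 1)"
    by (simp add: hardcore_angle_def cosh_arsinh_real)
  have t: "tanh (hardcore_angle d lam \<theta>) = ?s / sqrt (?s ^ 2 + 1)"
    by (simp add: tanh_def c) (simp add: hardcore_angle_def)
  have "((\<lambda>\<theta>. sqrt lam / cosh \<theta> ^ d) has_field_derivative - real d * tanh \<theta> * ?s) (at \<theta> within A)"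
    by (cases d, simp)
       (auto intro!: derivative_eq_intros simp: tanh_def divide_simps algebra_simps,
        metis One_nat_def mult.commute power_minus_mult)
  from DERIV_chain2[OF arsinh_real_has_field_derivative this]
  show ?thesis unfolding hardcore_angle_def[abs_def] t[unfolded hardcore_angle_def]
    by (simp add: mult_ac)
qed

text \<open>\<open>hardcore_F_times_arg_le\<close> at \<open>x = tanh t ^ 2\<close> bounds the
  squared derivative uniformly in \<open>t\<close>; the mean value inequality does the rest.\<close>

lemma hardcore_angle_contraction:
  assumes d: "2 \<le> d" and \<delta>: "0 < \<delta>" "\<delta> < 1" and lam: "lam = (1 - \<delta>) * lambda_c (Suc d)"
  defines "\<kappa> \<equiv> sqrt (1 - \<delta> / (1 + lam))"
  shows "0 \<le> \<kappa>" "\<kappa> < 1"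
    and "dist (hardcore_angle d lam \<theta>) (hardcore_angle d lam \<phi>) \<le> \<kappa> * dist \<theta> \<phi>"
proof -
  have lam0: "0 < lam" using lam \<delta> lambda_c_pos[OF d] by simp
  show "0 \<le> \<kappa>" "\<kappa> < 1" using lam0 \<delta> by (auto simp: \<kappa>_def)
  have "norm (- real d * tanh t * tanh (hardcore_angle d lam t)) \<le> \<kappa>" for t
  proof -
    have 1: "tanh t ^ 2 \<le> 1"
      using tanh_real_bounds[of t] by (simp add: abs_square_le_1 abs_le_iff)
    have "(real d * tanh t * tanh (hardcore_angle d lam t)) ^ 2
        = real d ^ 2 * tanh t ^ 2 * hardcore_F d lam (tanh t ^ 2)"
      using lam0 by (simp add: power_mult_distrib tanh_sq_hardcore_angle)
    also have "\<dots> \<le> 1 - \<delta> / (1 + lam)"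
      using 1 by (intro hardcore_F_times_arg_le d \<delta> lam) auto
    finally show ?thesis unfolding \<kappa>_def
      by (simp add: real_le_rsqrt power_mult_distrib)
  qed
  then show "dist (hardcore_angle d lam \<theta>) (hardcore_angle d lam \<phi>) \<le> \<kappa> * dist \<theta> \<phi>"
    unfolding dist_norm
    by (intro field_differentiable_bound[where S = UNIV and f' = "\<lambda>t. - real d * tanh t * tanh (hardcore_angle d lam t)"]
          hardcore_angle_has_derivative) auto
qed

text \<open>Banach's theorem for the angle map on the whole real line gives a fixed angle, which the
  iterates approach geometrically; squaring \<open>tanh\<close> carries this back to
  \<open>hardcore_F\<close>.\<close>

lemma hardcore_F_iterates_tendsto:
  assumes d: "2 \<le> d" and \<delta>: "0 < \<delta>" "\<delta> < 1" and lam: "lam = (1 - \<delta>) * lambda_c (Suc d)"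
  shows "\<exists>xh. 0 \<le> xh \<and> xh < 1 \<and> hardcore_F d lam xh = xh \<and> (\<lambda>n. (hardcore_F d lam ^^ n) 0) \<longlonglongrightarrow> xh"
proof -
  note contr = hardcore_angle_contraction[OF d \<delta> lam]
  define \<kappa> where "\<kappa> = sqrt (1 - \<delta> / (1 + lam))"
  let ?G = "hardcore_angle d lam"
  have lam0: "0 < lam" using lam \<delta> lambda_c_pos[OF d] by simp
  obtain \<theta> where \<theta>: "?G \<theta> = \<theta>"
    using banach_fix_type[OF contr(1,2), of ?G] contr(3) by blast
  have "dist ((?G ^^ n) 0) \<theta> \<le> \<kappa> ^ n * dist 0 \<theta>" for n
  proof (induction n)
    case (Suc n)
    have "dist ((?G ^^ Suc n) 0) \<theta> \<le> \<kappa> * dist ((?G ^^ n) 0) \<theta>"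
      using contr(3)[of "(?G ^^ n) 0" \<theta>] by (simp add: \<theta> \<kappa>_def)
    also have "\<dots> \<le> \<kappa> * (\<kappa> ^ n * dist 0 \<theta>)"
      using Suc contr(1) by (intro mult_left_mono) (auto simp: \<kappa>_def)
    finally show ?case by simp
  qed simp
  moreover have "(\<lambda>n. \<kappa> ^ n * dist 0 \<theta>) \<longlonglongrightarrow> 0"
    using contr(1,2) by (intro tendsto_mult_left_zero LIMSEQ_power_zero) (auto simp: \<kappa>_def)
  ultimately have "(\<lambda>n. dist ((?G ^^ n) 0) \<theta>) \<longlonglongrightarrow> 0"
    by (intro tendsto_sandwich[of "\<lambda>_. 0" "\<lambda>n. dist ((?G ^^ n) 0) \<theta>" sequentially "\<lambda>n. \<kappa> ^ n * dist 0 \<theta>"]) auto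
  then have "(\<lambda>n. (?G ^^ n) 0) \<longlonglongrightarrow> \<theta>" by (simp only: tendsto_dist_iff[symmetric])
  then have "(\<lambda>n. tanh ((?G ^^ n) 0) ^ 2) \<longlonglongrightarrow> tanh \<theta> ^ 2"
    by (intro tendsto_intros) auto
  \<comment> \<open>The squared \<open>tanh\<close> intertwines the two maps and sends the starting
    angle 0 to 0.\<close>
  moreover have "tanh ((?G ^^ n) 0) ^ 2 = (hardcore_F d lam ^^ n) 0" for n
    using lam0 by (induction n) (auto simp: tanh_sq_hardcore_angle)
  moreover have "hardcore_F d lam (tanh \<theta> ^ 2) = tanh \<theta> ^ 2"
    using tanh_sq_hardcore_angle[of lam d \<theta>] lam0 by (simp add: \<theta>)
  moreover have "tanh \<theta> ^ 2 < 1"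
    using tanh_real_bounds[of \<theta>] by (simp add: abs_square_less_1 abs_less_iff)
  ultimately show ?thesis by (intro exI[of _ "tanh \<theta> ^ 2"]) auto
qed

text \<open>At a fixed point the squared slope bounded above is \<open>(d * xh) ^ 2\<close>.\<close>

lemma fixed_point_less_inverse_degree:
  assumes d: "2 \<le> d" and \<delta>: "0 < \<delta>" "\<delta> < 1" and lam: "lam = (1 - \<delta>) * lambda_c (Suc d)"
    and xh: "0 \<le> xh" "xh \<le> 1" "hardcore_F d lam xh = xh"
  shows "real d * xh < 1"
proof -
  have "0 < lam" using lam \<delta> lambda_c_pos[OF d] by simp
  then have "0 < \<delta> / (1 + lam)" using \<delta> by simp
  then have "(real d * xh) ^ 2 < 1"
    using hardcore_F_times_arg_le[OF d \<delta> lam xh(1,2)] xh(3)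
    by (simp add: power_mult_distrib power2_eq_square mult_ac)
  then show ?thesis by (simp add: abs_square_less_1)
qed

text \<open>The candidate limit solves \<open>a = 1 + l * a\<close>. Up to a perturbation tending to
  0, the error is multiplied by \<open>\<bar>y n\<bar>\<close>, which is eventually below some
  \<open>q < 1\<close>.\<close>

lemma affine_recursion_tendsto:
  fixes a y :: "nat \<Rightarrow> real"
  assumes rec: "\<And>n. a (Suc n) = 1 + y n * a n" and y: "y \<longlonglongrightarrow> l" and l: "\<bar>l\<bar> < 1"
  shows "a \<longlonglongrightarrow> 1 / (1 - l)"
proof -
  define e where "e n = \<bar>a n - 1 / (1 - l)\<bar>" for n
  obtain q where q: "\<bar>l\<bar> < q" "q < 1" using l dense by blast
  have q0: "0 < q" using q by linarith
  have "(\<lambda>n. \<bar>y n\<bar>) \<longlonglongrightarrow> \<bar>l\<bar>" using y by (rule tendsto_rabs)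
  then have ev1: "eventually (\<lambda>n. \<bar>y n\<bar> < q) sequentially" using q(1) by (rule order_tendstoD)
  have b: "(\<lambda>n. \<bar>(y n - l) / (1 - l)\<bar>) \<longlonglongrightarrow> 0"
    using y l by (auto intro!: tendsto_eq_intros)
  have step: "e (Suc n) \<le> \<bar>y n\<bar> * e n + \<bar>(y n - l) / (1 - l)\<bar>" for n
  proof -
    have "a (Suc n) - 1 / (1 - l) = y n * (a n - 1 / (1 - l)) + (y n - l) / (1 - l)"
      using l by (simp add: rec divide_simps) (simp add: algebra_simps)
    then show ?thesis unfolding e_def by (simp add: abs_mult[symmetric] del: abs_divide)
  qed
  have "e \<longlonglongrightarrow> 0"
  proof (rule LIMSEQ_I)
    fix r :: real assume r: "0 < r"
    define \<epsilon> where "\<epsilon> = r / 2"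
    \<comment> \<open>With this threshold \<open>\<epsilon>\<close> is the fixed point of
      \<open>e \<mapsto> q * e + (1 - q) * \<epsilon>\<close>, so the excess over
      \<open>\<epsilon>\<close> contracts by \<open>q\<close>.\<close>
    have "eventually (\<lambda>n. \<bar>(y n - l) / (1 - l)\<bar> < (1 - q) * \<epsilon>) sequentially"
      using b by (rule order_tendstoD) (use q r in \<open>auto simp: \<epsilon>_def\<close>)
    with ev1 obtain N where N: "\<And>n. n \<ge> N \<Longrightarrow> \<bar>y n\<bar> < q \<and> \<bar>(y n - l) / (1 - l)\<bar> < (1 - q) * \<epsilon>"
      unfolding eventually_sequentially by (metis linorder_le_cases order_trans)
    have bd: "e (N + m) - \<epsilon> \<le> q ^ m * e N" for m
    proof (induction m)
      case (Suc m)
      have "e (N + Suc m) \<le> \<bar>y (N + m)\<bar> * e (N + m) + \<bar>(y (N + m) - l) / (1 - l)\<bar>"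
        using step[of "N + m"] by simp
      also have "\<dots> \<le> q * e (N + m) + (1 - q) * \<epsilon>"
        using N[of "N + m"] by (intro add_mono mult_right_mono) (auto simp: e_def)
      finally have "e (N + Suc m) - \<epsilon> \<le> q * (e (N + m) - \<epsilon>)" by (simp add: algebra_simps)
      also have "\<dots> \<le> q * (q ^ m * e N)" using Suc q0 by (intro mult_left_mono) auto
      finally show ?case by simp
    qed (use r in \<open>simp add: \<epsilon>_def\<close>)
    have "(\<lambda>m. q ^ m * e N) \<longlonglongrightarrow> 0"
      using q q0 by (intro tendsto_mult_left_zero LIMSEQ_power_zero) auto
    then have "eventually (\<lambda>m. q ^ m * e N < \<epsilon>) sequentially"
      by (rule order_tendstoD) (use r in \<open>simp add: \<epsilon>_def\<close>)
    then obtain M where M: "\<And>m. m \<ge> M \<Longrightarrow> q ^ m * e N < \<epsilon>"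
      unfolding eventually_sequentially by blast
    have "norm (e n - 0) < r" if "n \<ge> N + M" for n
      using bd[of "n - N"] M[of "n - N"] that by (simp add: \<epsilon>_def e_def le_diff_conv2)
    then show "\<exists>no. \<forall>n\<ge>no. norm (e n - 0) < r" by blast
  qed
  then have "(\<lambda>n. a n - 1 / (1 - l)) \<longlonglongrightarrow> 0"
    unfolding e_def by (simp only: tendsto_rabs_zero_iff)
  then show ?thesis by (rule LIM_zero_cancel)
qed

section \<open>Marginals and influences in induced subgraphs\<close>

locale hardcore_graph =
  fixes E :: "'v set set" and lam :: real
  assumes card_edge: "e \<in> E \<Longrightarrow> card e = 2" and lam_pos: "0 < lam"
begin

definition nbrs :: "'v \<Rightarrow> 'v set" where
  "nbrs v = {u. {u, v} \<in> E}"

abbreviation indep :: "'v set \<Rightarrow> 'v set set" where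
  "indep U \<equiv> indep_sets_of U E"

abbreviation Z :: "'v set \<Rightarrow> real" where
  "Z U \<equiv> hardcore_Z U E lam"

definition marg :: "'v set \<Rightarrow> 'v \<Rightarrow> real" where
  "marg U j = (\<Sum>S\<in>indep U. lam ^ card S * of_bool (j \<in> S)) / Z U"

text \<open>Setting \<open>v\<close> to 1 deletes \<open>v\<close> and its neighbours, setting it to
  0 deletes only \<open>v\<close>. This form avoids conditional probabilities;
  \<open>influence_pinned\<close> shows that it agrees with \<open>influence\<close>.\<close>

definition infl :: "'v set \<Rightarrow> 'v \<Rightarrow> 'v \<Rightarrow> real" where
  "infl U v j = (if j = v then 1 else marg (U - {v} - nbrs v) j - marg (U - {v}) j)"

section \<open>Conditioning on a single vertex\<close>

lemma edgeE:
  assumes "e \<in> E"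
  obtains u v where "e = {u, v}" "u \<noteq> v"
  using card_edge[OF assms] by (auto simp: card_2_iff)

lemma nbrs_irrefl: "v \<notin> nbrs v"
  using card_edge[of "{v}"] by (auto simp: nbrs_def)

lemma Z_pos: "finite U \<Longrightarrow> 0 < Z U"
  using card_edge[of "{}"] lam_pos by (intro hardcore_Z_pos) auto

lemma insert_indep_iff:
  assumes "v \<in> U" "v \<notin> S"
  shows "insert v S \<in> indep U \<longleftrightarrow> S \<in> indep (U - {v} - nbrs v)"
proof
  assume *: "insert v S \<in> indep U"
  have "u \<notin> nbrs v" if "u \<in> S" for u
    using * that by (auto simp: indep_sets_of_def nbrs_def)
  with * assms show "S \<in> indep (U - {v} - nbrs v)"
    by (fastforce simp: indep_sets_of_def)
next
  assume *: "S \<in> indep (U - {v} - nbrs v)"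
  have "\<not> e \<subseteq> insert v S" if e: "e \<in> E" for e
  proof
    assume sub: "e \<subseteq> insert v S"
    obtain a b where ab: "e = {a, b}" "a \<noteq> b" using edgeE[OF e] .
    have "\<not> e \<subseteq> S" using * e by (auto simp: indep_sets_of_def)
    then have "v \<in> e" using sub by blast
    then obtain u where u: "e = {u, v}" "u \<noteq> v" using ab by blast
    then have "u \<in> S" "u \<in> nbrs v" using sub e by (auto simp: nbrs_def)
    with * show False by (auto simp: indep_sets_of_def)
  qed
  with * assms show "insert v S \<in> indep U" by (auto simp: indep_sets_of_def)
qed

text \<open>Separates the sets avoiding \<open>v\<close> from those containing it. The arbitrary
  summand serves partition functions, marginals and joint events alike.\<close>

lemma sum_indep_split:
  assumes "finite U" "v \<in> U"
  shows "(\<Sum>S\<in>indep U. f S) =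
    (\<Sum>S\<in>indep (U - {v}). f S) + (\<Sum>S\<in>indep (U - {v} - nbrs v). f (insert v S))"
proof -
  have img: "indep U = indep (U - {v}) \<union> insert v ` indep (U - {v} - nbrs v)"
  proof (rule set_eqI)
    fix S
    show "S \<in> indep U \<longleftrightarrow> S \<in> indep (U - {v}) \<union> insert v ` indep (U - {v} - nbrs v)"
    proof (cases "v \<in> S")
      case False
      then show ?thesis by (auto simp: indep_sets_of_def)
    next
      case True
      then obtain T where T: "S = insert v T" "v \<notin> T" by (meson mk_disjoint_insert)
      have "S \<in> insert v ` indep (U - {v} - nbrs v) \<longleftrightarrow> T \<in> indep (U - {v} - nbrs v)"
      proof
        assume "S \<in> insert v ` indep (U - {v} - nbrs v)"
        then obtain T' where T': "T' \<in> indep (U - {v} - nbrs v)" "insert v T' = insert v T"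
          using T by auto
        then have "v \<notin> T'" by (auto simp: indep_sets_of_def)
        then show "T \<in> indep (U - {v} - nbrs v)" using T' T(2) by (simp add: insert_ident)
      qed (use T in auto)
      then show ?thesis
        using insert_indep_iff[OF assms(2) T(2)] T True by (auto simp: indep_sets_of_def)
    qed
  qed
  have "inj_on (insert v) (indep (U - {v} - nbrs v))"
  proof (rule inj_onI)
    fix S T
    assume *: "S \<in> indep (U - {v} - nbrs v)" "T \<in> indep (U - {v} - nbrs v)" "insert v S = insert v T"
    then have "v \<notin> S" "v \<notin> T" by (auto simp: indep_sets_of_def)
    with *(3) show "S = T" by (simp add: insert_ident)
  qed
  moreover have "indep (U - {v}) \<inter> insert v ` indep (U - {v} - nbrs v) = {}"
    by (auto simp: indep_sets_of_def)
  ultimately show ?thesis unfolding img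
    using assms by (subst sum.union_disjoint) (auto simp: finite_indep_sets_of sum.reindex)
qed

lemma card_insert_indep:
  "finite U \<Longrightarrow> S \<in> indep (U - {v} - nbrs v) \<Longrightarrow> card (insert v S) = Suc (card S)"
  by (subst card_insert_disjoint) (auto simp: indep_sets_of_def intro: finite_subset)

lemma Z_split:
  assumes "finite U" "v \<in> U"
  shows "Z U = Z (U - {v}) + lam * Z (U - {v} - nbrs v)"
  unfolding hardcore_Z_def sum_indep_split[OF assms]
  using assms by (simp add: card_insert_indep sum_distrib_left)

lemma marg_outside: "j \<notin> U \<Longrightarrow> marg U j = 0"
  by (auto simp: marg_def indep_sets_of_def intro!: sum.neutral)

lemma marg_self:
  assumes "finite U" "v \<in> U"
  shows "marg U v = lam * Z (U - {v} - nbrs v) / Z U"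
proof -
  have "(\<Sum>S\<in>indep (U - {v}). lam ^ card S * of_bool (v \<in> S)) = 0"
    by (rule sum.neutral) (auto simp: indep_sets_of_def)
  then show ?thesis unfolding marg_def sum_indep_split[OF assms]
    using assms by (simp add: card_insert_indep sum_distrib_left hardcore_Z_def)
qed

lemma marg_sum_eq:
  "finite U \<Longrightarrow> (\<Sum>S\<in>indep U. lam ^ card S * of_bool (j \<in> S)) = marg U j * Z U"
  using Z_pos[of U] by (simp add: marg_def)

lemma marg_split:
  assumes "finite U" "v \<in> U" "j \<noteq> v"
  shows "marg U j * Z U = marg (U - {v}) j * Z (U - {v}) + lam * Z (U - {v} - nbrs v) * marg (U - {v} - nbrs v) j"
proof -
  have "(\<Sum>S\<in>indep (U - {v} - nbrs v). lam ^ card (insert v S) * of_bool (j \<in> insert v S))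
     = lam * (\<Sum>S\<in>indep (U - {v} - nbrs v). lam ^ card S * of_bool (j \<in> S))"
    using assms by (auto simp: card_insert_indep sum_distrib_left intro!: sum.cong)
  then show ?thesis
    using sum_indep_split[OF assms(1,2), of "\<lambda>S. lam ^ card S * of_bool (j \<in> S)"] assms
    by (simp add: marg_sum_eq)
qed

lemma marg_bounds:
  assumes "finite U"
  shows "0 \<le> marg U v" "marg U v < 1"
proof -
  have "0 \<le> marg U v \<and> marg U v < 1"
  proof (cases "v \<in> U")
    case True
    then show ?thesis
      using Z_pos[of U] Z_pos[of "U - {v}"] Z_pos[of "U - {v} - nbrs v"] assms lam_pos
      by (simp add: marg_self Z_split[of U v] less_imp_le)
  qed (simp add: marg_outside)
  then show "0 \<le> marg U v" "marg U v < 1" by auto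
qed

text \<open>\<open>1 - marg U v\<close> is the probability that \<open>v\<close> is unoccupied;
  these ratios multiply when several vertices are deleted in turn.\<close>

lemma Z_delete:
  assumes "finite U" "v \<in> U"
  shows "Z (U - {v}) = Z U * (1 - marg U v)"
  using Z_split[OF assms] Z_pos[OF assms(1)] by (simp add: marg_self[OF assms] field_simps)

text \<open>Law of total probability for the state of \<open>v\<close>: \<open>marg U j\<close> is a
  mixture with weight \<open>marg U v\<close> on the occupied case. For \<open>j = v\<close> both
  sides are \<open>marg U v\<close>.\<close>

lemma marg_delete:
  assumes "finite U" "v \<in> U"
  shows "marg U j - marg (U - {v}) j = marg U v * infl U v j"
proof (cases "j = v")
  case True
  then show ?thesis by (simp add: infl_def marg_outside)
next
  case False
  have "marg U v * Z U = lam * Z (U - {v} - nbrs v)"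
    using Z_pos[OF assms(1)] by (simp add: marg_self[OF assms])
  then have "marg U j * Z U = (marg (U - {v}) j + marg U v * (marg (U - {v} - nbrs v) j - marg (U - {v}) j)) * Z U"
    unfolding marg_split[OF assms False] Z_delete[OF assms] by (simp add: ring_distribs mult_ac) algebra
  then have "marg U j = marg (U - {v}) j + marg U v * (marg (U - {v} - nbrs v) j - marg (U - {v}) j)"
    using Z_pos[OF assms(1)] by simp
  then show ?thesis using False by (simp add: infl_def)
qed

section \<open>Recursion over the neighbours of a vertex\<close>

text \<open>Deleting the vertices of \<open>N\<close> one at a time; \<open>W u\<close> is the vertex set from which \<open>u\<close> is deleted.\<close>

lemma delete_telescope:
  assumes "finite U" "N \<subseteq> U"
  shows "\<exists>W. (\<forall>u\<in>N. u \<in> W u \<and> U - N \<subseteq> W u \<and> W u \<subseteq> U) \<and>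
    Z (U - N) = Z U * (\<Prod>u\<in>N. 1 - marg (W u) u) \<and>
    (\<forall>j. marg U j - marg (U - N) j = (\<Sum>u\<in>N. marg (W u) u * infl (W u) u j))"
proof -
  have "finite N" using assms by (rule rev_finite_subset)
  then show ?thesis using assms(2)
  proof (induction N rule: finite_induct)
    case (insert v N)
    then obtain W where W: "\<forall>u\<in>N. u \<in> W u \<and> U - N \<subseteq> W u \<and> W u \<subseteq> U"
        "Z (U - N) = Z U * (\<Prod>u\<in>N. 1 - marg (W u) u)"
        "\<And>j. marg U j - marg (U - N) j = (\<Sum>u\<in>N. marg (W u) u * infl (W u) u j)"
      by auto
    \<comment> \<open>The vertex added by the induction is deleted last, hence from
      \<open>U - N\<close>; the earlier sets are kept.\<close>
    define W' where "W' = W(v := U - N)"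
    have eq: "U - insert v N = (U - N) - {v}" by auto
    have fin: "finite (U - N)" and v: "v \<in> U - N" using insert assms(1) by auto
    have W': "W' u = W u" if "u \<in> N" for u using that insert.hyps by (auto simp: W'_def)
    have W'v: "W' v = U - N" by (simp add: W'_def)
    have "\<forall>u\<in>insert v N. u \<in> W' u \<and> U - insert v N \<subseteq> W' u \<and> W' u \<subseteq> U"
      using W(1) v by (auto simp: W' W'v)
    moreover have "Z (U - insert v N) = Z U * (\<Prod>u\<in>insert v N. 1 - marg (W' u) u)"
      unfolding eq Z_delete[OF fin v] W(2) using insert.hyps by (simp add: W' W'v)
    moreover have "marg U j - marg (U - insert v N) j = (\<Sum>u\<in>insert v N. marg (W' u) u * infl (W' u) u j)" for j
      using marg_delete[OF fin v, of j] W(3)[of j] insert.hyps unfolding eq by (simp add: W' W'v)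
    ultimately show ?case by (intro exI[of _ W']) blast
  qed (auto intro: exI[of _ "\<lambda>_. U"])
qed

definition total_infl :: "'v set \<Rightarrow> 'v \<Rightarrow> real" where
  "total_infl U v = (\<Sum>j\<in>U. \<bar>infl U v j\<bar>)"

text \<open>The neighbours are deleted from \<open>U - {v}\<close>. Off the diagonal,
  \<open>infl U v j\<close> is minus the resulting drop in the marginal of \<open>j\<close>, hence
  the sign. The lower inclusion on \<open>W u\<close> later keeps whole branches of the tree
  intact.\<close>

lemma neighbourhood_recursion:
  assumes "finite U" "v \<in> U"
  obtains W where
    "\<And>u. u \<in> U \<inter> nbrs v \<Longrightarrow> u \<in> W u \<and> U - {v} - nbrs v \<subseteq> W u \<and> W u \<subseteq> U - {v}"
    "marg U v = lam * (\<Prod>u\<in>U \<inter> nbrs v. 1 - marg (W u) u) / (1 + lam * (\<Prod>u\<in>U \<inter> nbrs v. 1 - marg (W u) u))"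
    "\<And>j. j \<noteq> v \<Longrightarrow> infl U v j = - (\<Sum>u\<in>U \<inter> nbrs v. marg (W u) u * infl (W u) u j)"
proof -
  let ?U = "U - {v}" and ?N = "U \<inter> nbrs v"
  have N: "?N \<subseteq> ?U" using nbrs_irrefl by auto
  have eq: "?U - ?N = U - {v} - nbrs v" by auto
  have "finite ?U" using assms by simp
  then obtain W where W: "\<forall>u\<in>?N. u \<in> W u \<and> ?U - ?N \<subseteq> W u \<and> W u \<subseteq> ?U"
    "Z (?U - ?N) = Z ?U * (\<Prod>u\<in>?N. 1 - marg (W u) u)"
    "\<forall>j. marg ?U j - marg (?U - ?N) j = (\<Sum>u\<in>?N. marg (W u) u * infl (W u) u j)"
    using delete_telescope[OF _ N] by blast
  show ?thesis
  proof (rule that)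
    show "u \<in> W u \<and> U - {v} - nbrs v \<subseteq> W u \<and> W u \<subseteq> U - {v}" if "u \<in> ?N" for u
      using bspec[OF W(1) that] by (simp only: eq)
    have Z0: "0 < Z ?U" using assms Z_pos by auto
    have "marg U v = lam * (Z ?U * (\<Prod>u\<in>?N. 1 - marg (W u) u)) / (Z ?U + lam * (Z ?U * (\<Prod>u\<in>?N. 1 - marg (W u) u)))"
      using W(2) unfolding marg_self[OF assms] Z_split[OF assms] eq by simp
    also have "\<dots> = (Z ?U * (lam * (\<Prod>u\<in>?N. 1 - marg (W u) u))) / (Z ?U * (1 + lam * (\<Prod>u\<in>?N. 1 - marg (W u) u)))"
      by (simp add: algebra_simps)
    also have "\<dots> = lam * (\<Prod>u\<in>?N. 1 - marg (W u) u) / (1 + lam * (\<Prod>u\<in>?N. 1 - marg (W u) u))"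
      using Z0 by (subst mult_divide_mult_cancel_left) auto
    finally show "marg U v = lam * (\<Prod>u\<in>?N. 1 - marg (W u) u) / (1 + lam * (\<Prod>u\<in>?N. 1 - marg (W u) u))" .
    show "infl U v j = - (\<Sum>u\<in>?N. marg (W u) u * infl (W u) u j)" if "j \<noteq> v" for j
      using spec[OF W(3), of j] that by (simp add: infl_def eq)
  qed
qed

lemma infl_outside: "j \<notin> U \<Longrightarrow> j \<noteq> v \<Longrightarrow> infl U v j = 0"
  by (simp add: infl_def marg_outside)

text \<open>Triangle inequality and exchange of sums; the 1 is the influence of \<open>v\<close> on
  itself. The sets \<open>W\<close> are a parameter so that the same ones can be used in the formula
  for the marginal.\<close>

lemma total_infl_le_nbrs:
  assumes U: "finite U" "v \<in> U"
    and W: "\<And>u. u \<in> U \<inter> nbrs v \<Longrightarrow> u \<in> W u \<and> U - {v} - nbrs v \<subseteq> W u \<and> W u \<subseteq> U - {v}"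
      "\<And>j. j \<noteq> v \<Longrightarrow> infl U v j = - (\<Sum>u\<in>U \<inter> nbrs v. marg (W u) u * infl (W u) u j)"
  shows "total_infl U v \<le> 1 + (\<Sum>u\<in>U \<inter> nbrs v. marg (W u) u * total_infl (W u) u)"
proof -
  let ?N = "U \<inter> nbrs v"
  have "(\<Sum>j\<in>U - {v}. \<bar>infl U v j\<bar>) \<le> (\<Sum>j\<in>U - {v}. \<Sum>u\<in>?N. marg (W u) u * \<bar>infl (W u) u j\<bar>)"
  proof (rule sum_mono)
    fix j assume "j \<in> U - {v}"
    then have "\<bar>infl U v j\<bar> \<le> (\<Sum>u\<in>?N. \<bar>marg (W u) u * infl (W u) u j\<bar>)"
      using W(2)[of j] by (simp add: sum_abs)
    also have "\<dots> = (\<Sum>u\<in>?N. marg (W u) u * \<bar>infl (W u) u j\<bar>)"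
    proof (rule sum.cong)
      fix u assume "u \<in> ?N"
      then have "finite (W u)" using W(1) U(1) by (meson finite_Diff finite_subset)
      then show "\<bar>marg (W u) u * infl (W u) u j\<bar> = marg (W u) u * \<bar>infl (W u) u j\<bar>"
        using marg_bounds(1) by (simp add: abs_mult)
    qed simp
    finally show "\<bar>infl U v j\<bar> \<le> (\<Sum>u\<in>?N. marg (W u) u * \<bar>infl (W u) u j\<bar>)" .
  qed
  also have "\<dots> = (\<Sum>u\<in>?N. marg (W u) u * (\<Sum>j\<in>U - {v}. \<bar>infl (W u) u j\<bar>))"
    by (subst sum.swap) (simp add: sum_distrib_left)
  also have "\<dots> = (\<Sum>u\<in>?N. marg (W u) u * total_infl (W u) u)"
  proof (rule sum.cong)
    fix u assume u: "u \<in> ?N"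
    \<comment> \<open>\<open>W u\<close> may be smaller than \<open>U - {v}\<close>, but influences
      on vertices outside it vanish.\<close>
    have "(\<Sum>j\<in>U - {v}. \<bar>infl (W u) u j\<bar>) = total_infl (W u) u"
      unfolding total_infl_def using W(1)[OF u] U(1) infl_outside[of _ "W u" u]
      by (intro sum.mono_neutral_right) auto
    then show "marg (W u) u * (\<Sum>j\<in>U - {v}. \<bar>infl (W u) u j\<bar>) = marg (W u) u * total_infl (W u) u" by simp
  qed simp
  finally have "(\<Sum>j\<in>U - {v}. \<bar>infl U v j\<bar>) \<le> (\<Sum>u\<in>?N. marg (W u) u * total_infl (W u) u)" .
  then show ?thesis using U unfolding total_infl_def
    by (subst sum.remove[of U v]) (auto simp: infl_def)
qed

text \<open>Without absolute values the recursion is an equality. Weights \<open>s\<close>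
  alternating with the depth will undo its minus sign at every level.\<close>

lemma signed_infl_nbrs:
  assumes U: "finite U" "v \<in> U"
    and W: "\<And>u. u \<in> U \<inter> nbrs v \<Longrightarrow> u \<in> W u \<and> U - {v} - nbrs v \<subseteq> W u \<and> W u \<subseteq> U - {v}"
      "\<And>j. j \<noteq> v \<Longrightarrow> infl U v j = - (\<Sum>u\<in>U \<inter> nbrs v. marg (W u) u * infl (W u) u j)"
  shows "(\<Sum>j\<in>U. s j * infl U v j) =
    s v - (\<Sum>u\<in>U \<inter> nbrs v. marg (W u) u * (\<Sum>j\<in>W u. s j * infl (W u) u j))"
proof -
  let ?N = "U \<inter> nbrs v"
  have "(\<Sum>j\<in>U - {v}. s j * infl U v j) = (\<Sum>j\<in>U - {v}. - (\<Sum>u\<in>?N. marg (W u) u * (s j * infl (W u) u j)))"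
    by (intro sum.cong) (auto simp: W(2) sum_distrib_left mult_ac)
  also have "\<dots> = - (\<Sum>u\<in>?N. marg (W u) u * (\<Sum>j\<in>U - {v}. s j * infl (W u) u j))"
    by (simp only: sum_negf, subst sum.swap) (simp add: sum_distrib_left)
  also have "(\<Sum>u\<in>?N. marg (W u) u * (\<Sum>j\<in>U - {v}. s j * infl (W u) u j)) =
      (\<Sum>u\<in>?N. marg (W u) u * (\<Sum>j\<in>W u. s j * infl (W u) u j))"
  proof (rule sum.cong)
    fix u assume u: "u \<in> ?N"
    have "(\<Sum>j\<in>U - {v}. s j * infl (W u) u j) = (\<Sum>j\<in>W u. s j * infl (W u) u j)"
      using W(1)[OF u] U(1) infl_outside[of _ "W u" u]
      by (intro sum.mono_neutral_right) auto
    then show "marg (W u) u * (\<Sum>j\<in>U - {v}. s j * infl (W u) u j) =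
      marg (W u) u * (\<Sum>j\<in>W u. s j * infl (W u) u j)" by simp
  qed simp
  finally show ?thesis using U
    by (subst sum.remove[of U v]) (auto simp: infl_def)
qed

end

section \<open>Pinnings delete vertices\<close>

lemma prob_cond_pmf:
  assumes "measure_pmf.prob p A > 0"
  shows "measure_pmf.prob (cond_pmf p A) B = measure_pmf.prob p (A \<inter> B) / measure_pmf.prob p A"
proof -
  have ne: "set_pmf p \<inter> A \<noteq> {}"
    using assms by (metis less_irrefl measure_Int_set_pmf measure_empty inf_commute)
  have "measure_pmf.prob (cond_pmf p A) B = measure (uniform_measure (measure_pmf p) A) B"
    by (simp add: cond_pmf.rep_eq[OF ne])
  also have "\<dots> = measure_pmf.prob p (A \<inter> B) / measure_pmf.prob p A"
    using assms by (subst measure_uniform_measure) (auto simp: measure_pmf.emeasure_eq_measure)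
  finally show ?thesis .
qed

context hardcore_graph
begin

lemma prob_hardcore:
  assumes "finite V"
  shows "measure_pmf.prob (hardcore V E lam) A =
    (\<Sum>S\<in>indep V. lam ^ card S * of_bool ((\<lambda>v. v \<in> S) \<in> A)) / Z V"
proof -
  let ?p = "hardcore_set_pmf V E lam"
  have pmf: "pmf ?p S = (if S \<in> indep V then lam ^ card S / Z V else 0)" for S
    using assms lam_pos card_edge[of "{}"] by (intro pmf_hardcore_set_pmf) auto
  let ?B = "(\<lambda>S v. v \<in> S) -` A"
  have fin: "finite (indep V)" using assms by (rule finite_indep_sets_of)
  have set: "set_pmf ?p \<subseteq> indep V" by (auto simp: set_pmf_eq pmf)
  have "measure_pmf.prob (hardcore V E lam) A = measure_pmf.prob ?p ?B"
    by (simp add: hardcore_def)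
  also have "\<dots> = measure_pmf.prob ?p (?B \<inter> indep V)"
    using set by (intro measure_prob_cong_0) (auto simp: set_pmf_eq pmf)
  also have "\<dots> = (\<Sum>S\<in>?B \<inter> indep V. pmf ?p S)"
    using fin by (intro measure_measure_pmf_finite) auto
  also have "\<dots> = (\<Sum>S\<in>indep V. lam ^ card S / Z V * of_bool ((\<lambda>v. v \<in> S) \<in> A))"
    using fin by (intro sum.mono_neutral_cong_left) (auto simp: pmf)
  finally show ?thesis by (simp add: sum_divide_distrib)
qed

text \<open>Neighbours of a vertex pinned to 1 are forced to 0, so they leave the graph along with
  the pinned vertices.\<close>

definition free_verts :: "'v set \<Rightarrow> 'v set \<Rightarrow> ('v \<Rightarrow> bool) \<Rightarrow> 'v set" where
  "free_verts V \<Lambda> \<tau> = {v \<in> V - \<Lambda>. \<forall>u\<in>\<Lambda>. \<tau> u \<longrightarrow> u \<notin> nbrs v}"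

lemma agreeing_indep_bij:
  assumes pin: "pinning V (hardcore V E lam) \<Lambda> \<tau>" and V: "finite V"
  shows "bij_betw (\<lambda>T. T \<union> {i \<in> \<Lambda>. \<tau> i}) (indep (free_verts V \<Lambda> \<tau>))
    {S \<in> indep V. (\<lambda>v. v \<in> S) \<in> agrees \<Lambda> \<tau>}"
proof -
  let ?L = "{i \<in> \<Lambda>. \<tau> i}" and ?U = "free_verts V \<Lambda> \<tau>"
  have L: "\<Lambda> \<subseteq> V" and pos: "measure_pmf.prob (hardcore V E lam) (agrees \<Lambda> \<tau>) > 0"
    using pin by (auto simp: pinning_def)
  \<comment> \<open>Positive probability of the pinning provides a compatible independent set, so
    the vertices pinned to 1 are themselves independent.\<close>
  have "\<exists>S\<in>indep V. (\<lambda>v. v \<in> S) \<in> agrees \<Lambda> \<tau>"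
  proof (rule ccontr)
    assume "\<not> ?thesis"
    then have "measure_pmf.prob (hardcore V E lam) (agrees \<Lambda> \<tau>) = 0"
      by (simp add: prob_hardcore[OF V] sum.neutral)
    with pos show False by simp
  qed
  then obtain S0 where S0: "S0 \<in> indep V" "?L \<subseteq> S0" by (auto simp: agrees_def)
  have L_indep: "\<not> e \<subseteq> ?L" if "e \<in> E" for e
    using S0(1) that subset_trans[OF _ S0(2)] unfolding indep_sets_of_def by blast
  show ?thesis
  proof (rule bij_betwI[where g = "\<lambda>S. S - \<Lambda>"])
    show "(\<lambda>T. T \<union> ?L) \<in> indep ?U \<rightarrow> {S \<in> indep V. (\<lambda>v. v \<in> S) \<in> agrees \<Lambda> \<tau>}"
    proof (rule funcsetI, rule CollectI, rule conjI)
      fix T assume T: "T \<in> indep ?U"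
      then have TU: "T \<subseteq> ?U" by (auto simp: indep_sets_of_def)
      have "\<not> e \<subseteq> T \<union> ?L" if e: "e \<in> E" for e
      proof
        assume sub: "e \<subseteq> T \<union> ?L"
        obtain a b where ab: "e = {a, b}" using edgeE[OF e] .
        have no: False if "u \<in> ?L" "w \<in> T" "{u, w} \<in> E" for u w
          using that TU by (auto simp: free_verts_def nbrs_def)
        have "\<not> e \<subseteq> T" using T e by (auto simp: indep_sets_of_def)
        then show False using sub no[of a b] no[of b a] L_indep[OF e] e ab
          by (auto simp: insert_commute)
      qed
      then show "T \<union> ?L \<in> indep V" using TU L by (auto simp: indep_sets_of_def free_verts_def)
      show "(\<lambda>v. v \<in> T \<union> ?L) \<in> agrees \<Lambda> \<tau>" using TU by (auto simp: agrees_def free_verts_def)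
    qed
    show "(\<lambda>S. S - \<Lambda>) \<in> {S \<in> indep V. (\<lambda>v. v \<in> S) \<in> agrees \<Lambda> \<tau>} \<rightarrow> indep ?U"
      by (fastforce simp: indep_sets_of_def free_verts_def agrees_def nbrs_def)
    show "T \<union> ?L - \<Lambda> = T" if "T \<in> indep ?U" for T
      using that by (auto simp: indep_sets_of_def free_verts_def)
    show "S - \<Lambda> \<union> ?L = S" if "S \<in> {S \<in> indep V. (\<lambda>v. v \<in> S) \<in> agrees \<Lambda> \<tau>}" for S
      using that by (auto simp: agrees_def)
  qed
qed

text \<open>The vertices pinned to 1 contribute the same power of \<open>lam\<close> to every
  compatible set, and it cancels in the normalisation. What remains is the hardcore model on the
  free vertices.\<close>

lemma prob_pinned:
  assumes V: "finite V" and pin: "pinning V (hardcore V E lam) \<Lambda> \<tau>"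
  shows "measure_pmf.prob (pinned (hardcore V E lam) \<Lambda> \<tau>) A =
    (\<Sum>T\<in>indep (free_verts V \<Lambda> \<tau>). lam ^ card T * of_bool ((\<lambda>v. v \<in> T \<union> {i \<in> \<Lambda>. \<tau> i}) \<in> A))
      / Z (free_verts V \<Lambda> \<tau>)"
proof -
  let ?L = "{i \<in> \<Lambda>. \<tau> i}" and ?U = "free_verts V \<Lambda> \<tau>" and ?\<mu> = "hardcore V E lam"
  let ?J = "{S \<in> indep V. (\<lambda>v. v \<in> S) \<in> agrees \<Lambda> \<tau>}"
  have finL: "finite ?L" using pin V by (auto simp: pinning_def intro: finite_subset)
  have fin: "finite (indep V)" using V by (rule finite_indep_sets_of)
  have pos: "measure_pmf.prob ?\<mu> (agrees \<Lambda> \<tau>) > 0" using pin by (simp add: pinning_def)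
  have *: "measure_pmf.prob ?\<mu> (agrees \<Lambda> \<tau> \<inter> B) =
      lam ^ card ?L / Z V * (\<Sum>T\<in>indep ?U. lam ^ card T * of_bool ((\<lambda>v. v \<in> T \<union> ?L) \<in> B))" for B
  proof -
    have "(\<Sum>S\<in>indep V. lam ^ card S * of_bool ((\<lambda>v. v \<in> S) \<in> agrees \<Lambda> \<tau> \<inter> B)) =
      (\<Sum>S\<in>?J. lam ^ card S * of_bool ((\<lambda>v. v \<in> S) \<in> B))"
      using fin by (intro sum.mono_neutral_cong_right) auto
    also have "\<dots> = (\<Sum>T\<in>indep ?U. lam ^ card (T \<union> ?L) * of_bool ((\<lambda>v. v \<in> T \<union> ?L) \<in> B))"
      by (rule sum.reindex_bij_betw[OF agreeing_indep_bij[OF pin V], symmetric])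
    also have "\<dots> = (\<Sum>T\<in>indep ?U. lam ^ card ?L * (lam ^ card T * of_bool ((\<lambda>v. v \<in> T \<union> ?L) \<in> B)))"
    proof (rule sum.cong)
      fix T assume "T \<in> indep ?U"
      then have "T \<subseteq> V" "T \<inter> ?L = {}" by (auto simp: indep_sets_of_def free_verts_def)
      then have "card (T \<union> ?L) = card T + card ?L"
        using V finL by (intro card_Un_disjoint) (auto intro: finite_subset)
      then show "lam ^ card (T \<union> ?L) * of_bool ((\<lambda>v. v \<in> T \<union> ?L) \<in> B) =
         lam ^ card ?L * (lam ^ card T * of_bool ((\<lambda>v. v \<in> T \<union> ?L) \<in> B))" by (simp add: power_add)
    qed simp
    finally show ?thesis unfolding prob_hardcore[OF V] sum_distrib_left[symmetric] by simp
  qed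
  have den: "measure_pmf.prob ?\<mu> (agrees \<Lambda> \<tau>) = lam ^ card ?L / Z V * Z ?U"
    using *[of UNIV] by (simp add: hardcore_Z_def)
  have "lam ^ card ?L / Z V \<noteq> 0" using pos den by (metis less_irrefl mult_zero_left)
  then show ?thesis
    unfolding pinned_def prob_cond_pmf[OF pos] * den by (rule mult_divide_mult_cancel_left)
qed

text \<open>Both \<open>{}\<close> and \<open>{i}\<close> are independent, so a free vertex
  \<open>i\<close> takes both values; all other vertices are constant.\<close>

lemma active_pinned:
  assumes V: "finite V" and pin: "pinning V (hardcore V E lam) \<Lambda> \<tau>"
  shows "active V (pinned (hardcore V E lam) \<Lambda> \<tau>) = free_verts V \<Lambda> \<tau>"
proof -
  let ?U = "free_verts V \<Lambda> \<tau>" and ?L = "{i \<in> \<Lambda>. \<tau> i}"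
  let ?\<nu> = "pinned (hardcore V E lam) \<Lambda> \<tau>"
  have finU: "finite ?U" using V by (auto simp: free_verts_def)
  have fin: "finite (indep ?U)" using finU by (rule finite_indep_sets_of)
  have pos: "measure_pmf.prob ?\<nu> A > 0 \<longleftrightarrow> (\<exists>T\<in>indep ?U. (\<lambda>v. v \<in> T \<union> ?L) \<in> A)" for A
  proof
    assume "\<exists>T\<in>indep ?U. (\<lambda>v. v \<in> T \<union> ?L) \<in> A"
    then show "measure_pmf.prob ?\<nu> A > 0"
      unfolding prob_pinned[OF V pin] using fin lam_pos Z_pos[OF finU]
      by (auto intro!: divide_pos_pos sum_pos2)
  next
    assume *: "measure_pmf.prob ?\<nu> A > 0"
    show "\<exists>T\<in>indep ?U. (\<lambda>v. v \<in> T \<union> ?L) \<in> A"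
    proof (rule ccontr)
      assume "\<not> ?thesis"
      then have "measure_pmf.prob ?\<nu> A = 0" unfolding prob_pinned[OF V pin] by simp
      with * show False by simp
    qed
  qed
  have empty: "{} \<in> indep ?U" using card_edge[of "{}"] by (auto simp: indep_sets_of_def)
  have sing: "{i} \<in> indep ?U" if "i \<in> ?U" for i
    using that card_edge by (fastforce simp: indep_sets_of_def subset_singleton_iff)
  show ?thesis
  proof (intro equalityI subsetI)
    fix i assume "i \<in> active V ?\<nu>"
    then have i: "i \<in> V" "\<exists>T\<in>indep ?U. i \<notin> T \<union> ?L" "\<exists>T\<in>indep ?U. i \<in> T \<union> ?L"
      by (auto simp: active_def pos)
    then show "i \<in> ?U" by (auto simp: indep_sets_of_def)
  next
    fix i assume i: "i \<in> ?U"
    have "i \<notin> ?L" "i \<in> V" using i by (auto simp: free_verts_def)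
    then show "i \<in> active V ?\<nu>"
      using empty sing[OF i] by (auto simp: active_def pos)
  qed
qed

lemma influence_pinned:
  assumes V: "finite V" and pin: "pinning V (hardcore V E lam) \<Lambda> \<tau>"
    and i: "i \<in> free_verts V \<Lambda> \<tau>" and j: "j \<in> free_verts V \<Lambda> \<tau>"
  shows "influence (pinned (hardcore V E lam) \<Lambda> \<tau>) i j = infl (free_verts V \<Lambda> \<tau>) i j"
proof -
  let ?U = "free_verts V \<Lambda> \<tau>" and ?L = "{i \<in> \<Lambda>. \<tau> i}"
  let ?\<nu> = "pinned (hardcore V E lam) \<Lambda> \<tau>"
  let ?A = "?U - {i} - nbrs i" and ?B = "?U - {i}"
  have finU: "finite ?U" using V by (auto simp: free_verts_def)
  have nL: "i \<notin> ?L" "j \<notin> ?L" using i j by (auto simp: free_verts_def)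
  \<comment> \<open>One formula for an arbitrary event \<open>Q\<close> in the two coordinates; four
    choices of \<open>Q\<close> give all the probabilities in the two conditionals.\<close>
  have split: "measure_pmf.prob ?\<nu> {\<sigma>. Q (\<sigma> i) (\<sigma> j)} =
     ((\<Sum>T\<in>indep ?B. lam ^ card T * of_bool (Q False (j \<in> T))) +
      lam * (\<Sum>T\<in>indep ?A. lam ^ card T * of_bool (Q True (j = i \<or> j \<in> T)))) / Z ?U" for Q
  proof -
    have "measure_pmf.prob ?\<nu> {\<sigma>. Q (\<sigma> i) (\<sigma> j)} =
      (\<Sum>T\<in>indep ?U. lam ^ card T * of_bool (Q (i \<in> T) (j \<in> T))) / Z ?U"
      unfolding prob_pinned[OF V pin] using nL by (intro arg_cong2[where f = "(/)"] sum.cong) auto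
    also have "(\<Sum>T\<in>indep ?U. lam ^ card T * of_bool (Q (i \<in> T) (j \<in> T))) =
      (\<Sum>T\<in>indep ?B. lam ^ card T * of_bool (Q (i \<in> T) (j \<in> T))) +
      (\<Sum>T\<in>indep ?A. lam ^ card (insert i T) * of_bool (Q (i \<in> insert i T) (j \<in> insert i T)))"
      by (rule sum_indep_split[OF finU i])
    also have "(\<Sum>T\<in>indep ?B. lam ^ card T * of_bool (Q (i \<in> T) (j \<in> T))) =
      (\<Sum>T\<in>indep ?B. lam ^ card T * of_bool (Q False (j \<in> T)))"
    proof (rule sum.cong)
      fix T assume "T \<in> indep ?B"
      then have "i \<notin> T" by (auto simp: indep_sets_of_def)
      then show "lam ^ card T * of_bool (Q (i \<in> T) (j \<in> T)) = lam ^ card T * of_bool (Q False (j \<in> T))"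
        by simp
    qed simp
    also have "(\<Sum>T\<in>indep ?A. lam ^ card (insert i T) * of_bool (Q (i \<in> insert i T) (j \<in> insert i T))) =
       lam * (\<Sum>T\<in>indep ?A. lam ^ card T * of_bool (Q True (j = i \<or> j \<in> T)))"
      using finU by (simp add: card_insert_indep sum_distrib_left mult_ac)
    finally show ?thesis .
  qed
  have ZU: "0 < Z ?U" "0 < Z ?A" "0 < Z ?B" using finU Z_pos by auto
  have ii: "measure_pmf.prob ?\<nu> {\<sigma>. \<sigma> i} = lam * Z ?A / Z ?U"
    using split[of "\<lambda>a b. a"] by (simp add: hardcore_Z_def)
  have ni: "measure_pmf.prob ?\<nu> {\<sigma>. \<not> \<sigma> i} = Z ?B / Z ?U"
    using split[of "\<lambda>a b. \<not> a"] by (simp add: hardcore_Z_def)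
  have ij: "measure_pmf.prob ?\<nu> {\<sigma>. \<sigma> j \<and> \<sigma> i} = lam * (if j = i then Z ?A else marg ?A j * Z ?A) / Z ?U"
    using split[of "\<lambda>a b. b \<and> a"] finU marg_sum_eq[of ?A j] by (simp add: hardcore_Z_def)
  have nij: "measure_pmf.prob ?\<nu> {\<sigma>. \<sigma> j \<and> \<not> \<sigma> i} = marg ?B j * Z ?B / Z ?U"
    using split[of "\<lambda>a b. b \<and> \<not> a"] finU marg_sum_eq[of ?B j] by simp
  show ?thesis
  proof (cases "j = i")
    case True
    then have "marg ?B j = 0" by (simp add: marg_outside)
    then show ?thesis using True ZU lam_pos ii ij nij
      by (simp add: influence_def cond_prob_def infl_def)
  next
    case False
    then show ?thesis using ZU lam_pos by (simp add: influence_def cond_prob_def infl_def ii ni ij nij)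
  qed
qed

lemma max_influence_pinned:
  assumes V: "finite V" and pin: "pinning V (hardcore V E lam) \<Lambda> \<tau>"
  defines "U \<equiv> free_verts V \<Lambda> \<tau>"
  shows "max_influence V (pinned (hardcore V E lam) \<Lambda> \<tau>) = (if U = {} then 0 else (MAX i\<in>U. total_infl U i))"
proof -
  have "(\<Sum>j\<in>U. \<bar>influence (pinned (hardcore V E lam) \<Lambda> \<tau>) i j\<bar>) = total_infl U i" if "i \<in> U" for i
    unfolding total_infl_def using that influence_pinned[OF V pin]
    by (intro sum.cong) (auto simp: U_def)
  then show ?thesis
    unfolding max_influence_def active_pinned[OF V pin] U_def[symmetric]
    by (simp cong: image_cong_simp)
qed

end

section \<open>Upper bound for graphs of bounded degree\<close>

context hardcore_graph
begin

lemma nbrs_sym: "u \<in> nbrs v \<longleftrightarrow> v \<in> nbrs u"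
  by (simp add: nbrs_def insert_commute)

lemma card_nbrs_subset:
  assumes "finite U" "W \<subseteq> U" "card (U \<inter> nbrs w) \<le> k"
  shows "card (W \<inter> nbrs w) \<le> k"
  using card_mono[of "U \<inter> nbrs w" "W \<inter> nbrs w"] assms by fastforce

text \<open>When the recursion moves from \<open>v\<close> to a neighbour \<open>u\<close>, that
  neighbour has lost \<open>v\<close>. Hence every step after the first sees at most
  \<open>d\<close> neighbours.\<close>

lemma card_nbrs_delete:
  assumes "finite U" "W \<subseteq> U - {v}" "v \<in> U" "v \<in> nbrs u" "card (U \<inter> nbrs u) \<le> Suc k"
  shows "card (W \<inter> nbrs u) \<le> k"
proof -
  have "card (W \<inter> nbrs u) \<le> card (U \<inter> nbrs u - {v})"
    using assms by (intro card_mono) auto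
  also have "\<dots> = card (U \<inter> nbrs u) - 1"
    using assms by (subst card_Diff_singleton) auto
  finally show ?thesis using assms(5) by simp
qed

text \<open>The two bounds are proved simultaneously: at a neighbour \<open>u\<close> with marginal \<open>x\<close> they say that
  \<open>x * total_infl\<close> is at most \<open>K * min x xh\<close> with \<open>K = 1 / (1 - d * xh)\<close>.\<close>

lemma total_infl_bound:
  assumes xh: "0 \<le> xh" "xh < 1" "real d * xh < 1" "hardcore_F d lam xh = xh"
    and "finite U" "v \<in> U" "card (U \<inter> nbrs v) \<le> d" "\<And>u. u \<in> U \<Longrightarrow> card (U \<inter> nbrs u) \<le> Suc d"
  shows "total_infl U v \<le> 1 / (1 - real d * xh) \<and> marg U v * total_infl U v \<le> xh / (1 - real d * xh)"
  using assms(5-)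
proof (induction "card U" arbitrary: U v rule: less_induct)
  case less
  let ?K = "1 / (1 - real d * xh)" and ?N = "U \<inter> nbrs v"
  obtain W where W:
    "\<And>u. u \<in> ?N \<Longrightarrow> u \<in> W u \<and> U - {v} - nbrs v \<subseteq> W u \<and> W u \<subseteq> U - {v}"
    "marg U v = lam * (\<Prod>u\<in>?N. 1 - marg (W u) u) / (1 + lam * (\<Prod>u\<in>?N. 1 - marg (W u) u))"
    "\<And>j. j \<noteq> v \<Longrightarrow> infl U v j = - (\<Sum>u\<in>?N. marg (W u) u * infl (W u) u j)"
    using neighbourhood_recursion[OF less.prems(1,2)] by blast
  have finN: "finite ?N" using less.prems by simp
  have finW: "finite (W u)" if "u \<in> ?N" for u
    using W(1)[OF that] less.prems(1) by (meson finite_Diff finite_subset)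
  have IH: "total_infl (W u) u \<le> ?K \<and> marg (W u) u * total_infl (W u) u \<le> xh / (1 - real d * xh)"
    if u: "u \<in> ?N" for u
  proof (rule less.hyps)
    have sub: "W u \<subseteq> U - {v}" and uW: "u \<in> W u" using W(1)[OF u] by auto
    show "finite (W u)" "u \<in> W u" using finW[OF u] uW by auto
    have "W u \<subset> U" using sub less.prems(2) by blast
    then show "card (W u) < card U" using less.prems(1) by (rule psubset_card_mono[rotated])
    show "card (W u \<inter> nbrs u) \<le> d"
      using card_nbrs_delete[OF less.prems(1) sub] u less.prems(2,4) nbrs_sym by blast
    show "card (W u \<inter> nbrs w) \<le> Suc d" if "w \<in> W u" for w
      using card_nbrs_subset[of U "W u"] sub less.prems(1,4) that by blast
  qed
  note T = total_infl_le_nbrs[OF less.prems(1,2) W(1,3)]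
  \<comment> \<open>Each product is at most \<open>K * xh\<close>, and
    \<open>1 + d * K * xh = K\<close>.\<close>
  have "(\<Sum>u\<in>?N. marg (W u) u * total_infl (W u) u) \<le> (\<Sum>u\<in>?N. xh / (1 - real d * xh))"
    using IH by (intro sum_mono) blast
  also have "\<dots> = real (card ?N) * (xh / (1 - real d * xh))" by simp
  also have "\<dots> \<le> real d * (xh / (1 - real d * xh))"
    using less.prems(3) xh by (intro mult_right_mono) auto
  finally have "total_infl U v \<le> 1 + real d * (xh / (1 - real d * xh))" using T by linarith
  also have "\<dots> = ?K" using xh by (simp add: field_simps)
  finally have 1: "total_infl U v \<le> ?K" .
  \<comment> \<open>Now the other half of the induction hypothesis, keeping the marginals, to reach
    the form of \<open>sum_recursion_bound\<close>.\<close>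
  have "(\<Sum>u\<in>?N. marg (W u) u * total_infl (W u) u) \<le> (\<Sum>u\<in>?N. marg (W u) u * ?K)"
    using IH marg_bounds(1)[OF finW] by (intro sum_mono mult_left_mono) blast+
  also have "\<dots> = (\<Sum>u\<in>?N. marg (W u) u) / (1 - real d * xh)"
    by (simp add: sum_divide_distrib)
  finally have "total_infl U v \<le> 1 + (\<Sum>u\<in>?N. marg (W u) u) / (1 - real d * xh)"
    using T by linarith
  then have "marg U v * total_infl U v \<le> marg U v * (1 + (\<Sum>u\<in>?N. marg (W u) u) / (1 - real d * xh))"
    using marg_bounds(1)[OF less.prems(1)] by (rule mult_left_mono)
  also have "\<dots> \<le> xh / (1 - real d * xh)"
    unfolding W(2)
    by (rule sum_recursion_bound[OF finN less.prems(3) _ lam_pos xh(2-4)])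
       (use marg_bounds(2)[OF finW] in \<open>auto intro: less_imp_le\<close>)
  finally show ?case using 1 by blast
qed

text \<open>At the first vertex no neighbour has been deleted yet, so \<open>d + 1\<close> terms of
  size \<open>K * xh\<close> may occur instead of \<open>d\<close>.\<close>

lemma total_infl_le:
  assumes xh: "0 \<le> xh" "xh < 1" "real d * xh < 1" "hardcore_F d lam xh = xh"
    and U: "finite U" "v \<in> U" "\<And>u. u \<in> U \<Longrightarrow> card (U \<inter> nbrs u) \<le> Suc d"
  shows "total_infl U v \<le> (1 + xh) / (1 - real d * xh)"
proof -
  let ?N = "U \<inter> nbrs v"
  obtain W where W:
    "\<And>u. u \<in> ?N \<Longrightarrow> u \<in> W u \<and> U - {v} - nbrs v \<subseteq> W u \<and> W u \<subseteq> U - {v}"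
    "marg U v = lam * (\<Prod>u\<in>?N. 1 - marg (W u) u) / (1 + lam * (\<Prod>u\<in>?N. 1 - marg (W u) u))"
    "\<And>j. j \<noteq> v \<Longrightarrow> infl U v j = - (\<Sum>u\<in>?N. marg (W u) u * infl (W u) u j)"
    using neighbourhood_recursion[OF U(1,2)] by blast
  have bd: "marg (W u) u * total_infl (W u) u \<le> xh / (1 - real d * xh)" if u: "u \<in> ?N" for u
  proof -
    have sub: "W u \<subseteq> U - {v}" and uW: "u \<in> W u" using W(1)[OF u] by auto
    have fin: "finite (W u)" using sub U(1) by (meson finite_Diff finite_subset)
    have "card (W u \<inter> nbrs u) \<le> d"
      using card_nbrs_delete[OF U(1) sub] u U(2,3) nbrs_sym by blast
    moreover have "card (W u \<inter> nbrs w) \<le> Suc d" if "w \<in> W u" for w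
      using card_nbrs_subset[of U "W u"] sub U(1,3) that by blast
    ultimately show ?thesis using total_infl_bound[OF xh fin uW] by blast
  qed
  have "total_infl U v \<le> 1 + (\<Sum>u\<in>?N. marg (W u) u * total_infl (W u) u)"
    by (rule total_infl_le_nbrs[OF U(1,2) W(1,3)])
  also have "(\<Sum>u\<in>?N. marg (W u) u * total_infl (W u) u) \<le> (\<Sum>u\<in>?N. xh / (1 - real d * xh))"
    using bd by (intro sum_mono)
  also have "\<dots> = real (card ?N) * (xh / (1 - real d * xh))" by simp
  also have "\<dots> \<le> real (Suc d) * (xh / (1 - real d * xh))"
    using U(3)[OF U(2)] xh by (intro mult_right_mono of_nat_mono) auto
  also have "1 + real (Suc d) * (xh / (1 - real d * xh)) = (1 + xh) / (1 - real d * xh)"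
    using xh by (simp add: field_simps)
  finally show ?thesis by simp
qed

lemma linf_SI_constant_le:
  assumes xh: "0 \<le> xh" "xh < 1" "real d * xh < 1" "hardcore_F d lam xh = xh"
    and V: "finite V" "\<And>u. u \<in> V \<Longrightarrow> card (V \<inter> nbrs u) \<le> Suc d"
  shows "linf_SI_constant V (hardcore V E lam) \<le> (1 + xh) / (1 - real d * xh)"
  unfolding linf_spectrally_independent_iff[OF V(1), symmetric] linf_spectrally_independent_def
proof (intro allI impI)
  fix \<Lambda> \<tau> assume pin: "pinning V (hardcore V E lam) \<Lambda> \<tau>"
  let ?U = "free_verts V \<Lambda> \<tau>"
  have sub: "?U \<subseteq> V" by (auto simp: free_verts_def)
  then have fin: "finite ?U" using V(1) by (rule finite_subset)
  have "card (?U \<inter> nbrs u) \<le> Suc d" if "u \<in> ?U" for u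
    using card_nbrs_subset[OF V(1) sub] V(2) sub that by blast
  then have "total_infl ?U i \<le> (1 + xh) / (1 - real d * xh)" if "i \<in> ?U" for i
    using total_infl_le[OF xh fin that] by blast
  then show "max_influence V (pinned (hardcore V E lam) \<Lambda> \<tau>) \<le> (1 + xh) / (1 - real d * xh)"
    using xh fin by (auto simp: max_influence_pinned[OF V(1) pin])
qed

text \<open>The empty pinning competes in the supremum and leaves every vertex free.\<close>

lemma linf_SI_constant_ge:
  assumes V: "finite V" "v \<in> V"
  shows "total_infl V v \<le> linf_SI_constant V (hardcore V E lam)"
proof -
  let ?\<mu> = "hardcore V E lam"
  have pin: "pinning V ?\<mu> {} \<tau>" for \<tau> by (simp add: pinning_def agrees_def)
  have free: "free_verts V {} \<tau> = V" for \<tau> by (simp add: free_verts_def)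
  have "total_infl V v \<le> (MAX i\<in>V. total_infl V i)" using V by (intro Max_ge) auto
  also have "\<dots> = max_influence V (pinned ?\<mu> {} (\<lambda>_. False))"
    using V by (auto simp: max_influence_pinned[OF V(1) pin] free)
  also have "\<dots> \<le> linf_SI_constant V ?\<mu>"
    using linf_spectrally_independent_iff[OF V(1), of ?\<mu> "linf_SI_constant V ?\<mu>"] pin
    by (auto simp: linf_spectrally_independent_def)
  finally show ?thesis .
qed

end

section \<open>Lower bound at the root of the tree\<close>

locale hardcore_tree =
  fixes d h :: nat and lam :: real
  assumes lam_positive: "0 < lam"
begin

section \<open>Adjacency and degrees in the tree\<close>

abbreviation V :: "nat list set" where
  "V \<equiv> tree_verts (Suc d) h"

lemma append_in_verts:
  assumes "w @ z \<in> V"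
  shows "w \<in> V"
proof -
  have "w ! k < (if k = 0 then Suc d else Suc d - 1)" if "k < length w" for k
  proof -
    have "(w @ z) ! k < (if k = 0 then Suc d else Suc d - 1)"
      using assms that unfolding tree_verts_def mem_Collect_eq by (metis length_append trans_less_add1)
    then show ?thesis using that by (simp only: nth_append if_True)
  qed
  moreover have "length w \<le> h" using assms by (simp add: tree_verts_def)
  ultimately show ?thesis unfolding tree_verts_def by blast
qed

lemma child_in_verts_iff:
  "w @ [c] \<in> V \<longleftrightarrow> w \<in> V \<and> length w < h \<and> c < (if w = [] then Suc d else d)"
proof
  assume *: "w @ [c] \<in> V"
  then have "c < (if w = [] then Suc d else d)"
    unfolding tree_verts_def by (auto simp: nth_append dest!: spec[of _ "length w"])
  with * append_in_verts[OF *] show "w \<in> V \<and> length w < h \<and> c < (if w = [] then Suc d else d)"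
    by (auto simp: tree_verts_def)
next
  assume "w \<in> V \<and> length w < h \<and> c < (if w = [] then Suc d else d)"
  then show "w @ [c] \<in> V"
    by (auto simp: tree_verts_def nth_append less_Suc_eq split: if_splits)
qed

sublocale hardcore_graph "tree_edges (Suc d) h" lam
  by unfold_locales (auto simp: tree_edges_def lam_positive)

lemma nbrs_tree: "nbrs w = {u. (\<exists>c. u = w @ [c] \<and> u \<in> V) \<or> (\<exists>c. w = u @ [c] \<and> w \<in> V)}"
proof -
  have edge: "u \<in> nbrs w \<longleftrightarrow> (\<exists>v c. {u, w} = {v, v @ [c]} \<and> v @ [c] \<in> V)" for u
    unfolding nbrs_def mem_Collect_eq unfolding tree_edges_def mem_Collect_eq ..
  have "u \<in> nbrs w \<longleftrightarrow> (\<exists>c. u = w @ [c] \<and> u \<in> V) \<or> (\<exists>c. w = u @ [c] \<and> w \<in> V)" for u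
    unfolding edge
  proof
    assume "\<exists>v c. {u, w} = {v, v @ [c]} \<and> v @ [c] \<in> V"
    then obtain v c where vc: "{u, w} = {v, v @ [c]}" "v @ [c] \<in> V" by iprover
    from vc(1) consider "u = v" "w = v @ [c]" | "u = v @ [c]" "w = v"
      unfolding doubleton_eq_iff by iprover
    then show "(\<exists>c. u = w @ [c] \<and> u \<in> V) \<or> (\<exists>c. w = u @ [c] \<and> w \<in> V)"
      by cases (use vc(2) in simp_all)
  next
    assume "(\<exists>c. u = w @ [c] \<and> u \<in> V) \<or> (\<exists>c. w = u @ [c] \<and> w \<in> V)"
    then show "\<exists>v c. {u, w} = {v, v @ [c]} \<and> v @ [c] \<in> V"
      by (metis insert_commute)
  qed
  then show ?thesis by (intro set_eqI) simp
qed

definition children :: "nat list \<Rightarrow> nat list set" where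
  "children w = {w @ [c] | c. w @ [c] \<in> V}"

lemma children_eq:
  "w \<in> V \<Longrightarrow> length w < h \<Longrightarrow> children w = (\<lambda>c. w @ [c]) ` {..<if w = [] then Suc d else d}"
  by (auto simp: children_def child_in_verts_iff)

lemma card_children:
  "w \<in> V \<Longrightarrow> card (children w) = (if length w < h then if w = [] then Suc d else d else 0)"
  by (cases "length w < h")
     (simp_all add: children_eq card_image inj_on_def, simp add: children_def child_in_verts_iff)

lemma card_nbrs_le:
  assumes "w \<in> V"
  shows "card (V \<inter> nbrs w) \<le> Suc d"
proof (cases "w = []")
  case True
  then have "V \<inter> nbrs w = children w" by (auto simp: nbrs_tree children_def)
  then show ?thesis using card_children[OF assms] by auto
next
  case False
  have "finite (children w)" using finite_tree_verts by (rule rev_finite_subset) (auto simp: children_def)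
  then have "card (V \<inter> nbrs w) \<le> card (insert (butlast w) (children w))"
    by (intro card_mono) (auto simp: nbrs_tree children_def)
  also have "\<dots> \<le> Suc (card (children w))" by (rule card_insert_le_m1) simp_all
  finally show ?thesis using card_children[OF assms] False by (auto split: if_splits)
qed

text \<open>Deleting siblings one at a time leaves an irregular vertex set, so the invariant
  concerns only the branch at \<open>w\<close>. With the parent absent, the rest of \<open>U\<close>
  is disconnected from it.\<close>

definition has_full_branch :: "nat list set \<Rightarrow> nat list \<Rightarrow> bool" where
  "has_full_branch U w \<longleftrightarrow> w \<in> V \<and> U \<subseteq> V \<and> (\<forall>z. w @ z \<in> V \<longrightarrow> w @ z \<in> U) \<and> (w \<noteq> [] \<longrightarrow> butlast w \<notin> U)"

definition sgn_infl :: "nat list set \<Rightarrow> nat list \<Rightarrow> real" where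
  "sgn_infl U w = (\<Sum>j\<in>U. (-1) ^ length j * infl U w j)"

text \<open>The assumption quantifies over all \<open>W\<close> because the recursion does not
  reveal which sets it uses. Common values \<open>x\<close> and \<open>a\<close> at all children
  turn product and sum into a power and a multiple.\<close>

lemma branch_step:
  assumes br: "has_full_branch U w"
    and IH: "\<And>c W. has_full_branch W (w @ [c]) \<Longrightarrow>
      marg W (w @ [c]) = x \<and> sgn_infl W (w @ [c]) = (-1) ^ Suc (length w) * a"
  defines "k \<equiv> card (children w)"
  shows "marg U w = hardcore_F k lam x"
    and "sgn_infl U w = (-1) ^ length w * (1 + real k * (x * a))"
proof -
  let ?N = "U \<inter> nbrs w"
  have wU: "w \<in> U" using br unfolding has_full_branch_def by (metis append_Nil2)
  have finU: "finite U" using br finite_tree_verts by (auto simp: has_full_branch_def intro: finite_subset)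
  have N: "?N = children w"
    using br by (auto simp: has_full_branch_def nbrs_tree children_def)
  obtain W where W:
    "\<And>u. u \<in> ?N \<Longrightarrow> u \<in> W u \<and> U - {w} - nbrs w \<subseteq> W u \<and> W u \<subseteq> U - {w}"
    "marg U w = lam * (\<Prod>u\<in>?N. 1 - marg (W u) u) / (1 + lam * (\<Prod>u\<in>?N. 1 - marg (W u) u))"
    "\<And>j. j \<noteq> w \<Longrightarrow> infl U w j = - (\<Sum>u\<in>?N. marg (W u) u * infl (W u) u j)"
    using neighbourhood_recursion[OF finU wU] by blast
  have child: "marg (W u) u = x \<and> sgn_infl (W u) u = (-1) ^ Suc (length w) * a" if u: "u \<in> ?N" for u
  proof -
    obtain c where c: "u = w @ [c]" "u \<in> V" using u N by (auto simp: children_def)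
    have "u @ z \<in> W u" if z: "u @ z \<in> V" for z
    proof (cases "z = []")
      case True
      then show ?thesis using W(1)[OF u] by simp
    next
      case False
      have "w @ (c # z) \<in> V" using z c by simp
      then have "u @ z \<in> U" using br c unfolding has_full_branch_def by (metis append.assoc append_Cons append_Nil)
      moreover have "u @ z \<noteq> w" "u @ z \<notin> nbrs w"
        using c False by (auto simp: nbrs_tree)
      ultimately show ?thesis using W(1)[OF u] by blast
    qed
    \<comment> \<open>Proper descendants of \<open>u\<close> are neither \<open>w\<close> nor
      adjacent to it, so they survive, while the parent \<open>w\<close> is gone.\<close>
    then have "has_full_branch (W u) u"
      using W(1)[OF u] br c by (auto simp: has_full_branch_def)
    then show ?thesis using IH c by simp
  qed
  have "(\<Prod>u\<in>?N. 1 - marg (W u) u) = (\<Prod>u\<in>?N. 1 - x)" using child by (intro prod.cong) auto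
  then have "(\<Prod>u\<in>?N. 1 - marg (W u) u) = (1 - x) ^ k" by (simp add: N k_def)
  then show "marg U w = hardcore_F k lam x" using W(2) by (simp add: hardcore_F_def)
  have "sgn_infl U w = (-1) ^ length w - (\<Sum>u\<in>?N. marg (W u) u * sgn_infl (W u) u)"
    unfolding sgn_infl_def by (rule signed_infl_nbrs[OF finU wU W(1,3)])
  also have "(\<Sum>u\<in>?N. marg (W u) u * sgn_infl (W u) u) = (\<Sum>u\<in>?N. x * ((-1) ^ Suc (length w) * a))"
    using child by (intro sum.cong) auto
  finally show "sgn_infl U w = (-1) ^ length w * (1 + real k * (x * a))"
    by (simp add: N k_def algebra_simps)
qed

end

text \<open>The signed influence sum, up to its leading sign, at a non-root vertex with the given
  number of levels below. A child with \<open>n\<close> levels below it has marginal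
  \<open>(hardcore_F d lam ^^ Suc n) 0\<close>.\<close>

primrec branch_infl :: "nat \<Rightarrow> real \<Rightarrow> nat \<Rightarrow> real" where
  "branch_infl d lam 0 = 1"
| "branch_infl d lam (Suc n) = 1 + real d * (hardcore_F d lam ^^ Suc n) 0 * branch_infl d lam n"

context hardcore_tree
begin

lemma branch_values:
  assumes "has_full_branch U w" "w \<noteq> []" "length w + n = h"
  shows "marg U w = (hardcore_F d lam ^^ Suc n) 0 \<and> sgn_infl U w = (-1) ^ length w * branch_infl d lam n"
  using assms
proof (induction n arbitrary: U w)
  case 0
  have leaf: "w @ [c] \<notin> V" for c using 0 by (simp add: child_in_verts_iff)
  \<comment> \<open>A leaf has no children, so the assumption of \<open>branch_step\<close> is
    vacuous and 0 serves as a dummy for both values. At 0 the exponent of \<open>hardcore_F\<close>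
    does not matter.\<close>
  then have IH: "marg W (w @ [c]) = 0 \<and> sgn_infl W (w @ [c]) = (-1) ^ Suc (length w) * 0"
    if "has_full_branch W (w @ [c])" for W c
    using that by (simp add: has_full_branch_def)
  have "card (children w) = 0" using leaf by (simp add: children_def)
  then show ?case using branch_step[OF 0(1) IH] by (simp add: hardcore_F_def)
next
  case (Suc n)
  have IH: "marg W (w @ [c]) = (hardcore_F d lam ^^ Suc n) 0 \<and>
      sgn_infl W (w @ [c]) = (-1) ^ Suc (length w) * branch_infl d lam n"
    if "has_full_branch W (w @ [c])" for W c
    using Suc.IH[OF that] Suc.prems by simp
  have "w \<in> V" using Suc.prems by (simp add: has_full_branch_def)
  then have "card (children w) = d" using card_children Suc.prems by simp
  then show ?case using branch_step[OF Suc.prems(1) IH] by (simp add: mult.assoc)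
qed

text \<open>The root is the only vertex with \<open>d + 1\<close> children, so it gets its own
  recursion step; passing to absolute values then gives the inequality.\<close>

lemma total_infl_root_ge:
  assumes "h = Suc n"
  shows "1 + real (Suc d) * ((hardcore_F d lam ^^ Suc n) 0 * branch_infl d lam n) \<le> total_infl V []"
proof -
  have root: "[] \<in> V" by (simp add: tree_verts_def)
  have br: "has_full_branch V []" using root by (simp add: has_full_branch_def)
  have IH: "marg W ([] @ [c]) = (hardcore_F d lam ^^ Suc n) 0 \<and>
      sgn_infl W ([] @ [c]) = (-1) ^ Suc (length ([] :: nat list)) * branch_infl d lam n"
    if "has_full_branch W ([] @ [c])" for W c
    using branch_values[OF that, of n] assms by simp
  have "card (children []) = Suc d" using card_children[OF root] assms by simp
  then have "1 + real (Suc d) * ((hardcore_F d lam ^^ Suc n) 0 * branch_infl d lam n) = sgn_infl V []"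
    using branch_step(2)[OF br IH] by simp
  also have "\<dots> \<le> total_infl V []"
    unfolding sgn_infl_def total_infl_def
  proof (rule sum_mono)
    fix j :: "nat list"
    have "(-1) ^ length j * infl V [] j \<le> \<bar>(-1) ^ length j * infl V [] j\<bar>" by (rule abs_ge_self)
    then show "(-1) ^ length j * infl V [] j \<le> \<bar>infl V [] j\<bar>" by (simp add: abs_mult power_abs)
  qed
  finally show ?thesis .
qed

end

section \<open>Squeezing the constant between the root value and the degree bound\<close>

theorem theorem3p2:
  fixes \<Delta> d :: nat and \<delta> lam :: real
  assumes "\<Delta> = d + 1" and "\<Delta> \<ge> 3"
    and "0 < \<delta>" and "\<delta> < 1"
    and "lam = (1 - \<delta>) * lambda_c \<Delta>"
  shows "(\<exists>!x. x \<in> {0..1} \<and> hardcore_F d lam x = x) \<and>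
    (\<forall>xhat\<in>{0..1}. hardcore_F d lam xhat = xhat \<longrightarrow>
      (\<lambda>h. linf_SI_constant (tree_verts \<Delta> h) (hardcore (tree_verts \<Delta> h) (tree_edges \<Delta> h) lam))
        \<longlonglongrightarrow> (1 + xhat) / (1 - real d * xhat))"
proof -
  have \<Delta>: "\<Delta> = Suc d" and d: "2 \<le> d" using assms by auto
  note \<delta> = assms(3,4)
  have lam: "lam = (1 - \<delta>) * lambda_c (Suc d)" using assms(5) \<Delta> by simp
  have lam0: "0 < lam" using lam \<delta> lambda_c_pos[OF d] by simp
  obtain xh where xh: "0 \<le> xh" "xh < 1" "hardcore_F d lam xh = xh"
    and lim: "(\<lambda>n. (hardcore_F d lam ^^ n) 0) \<longlonglongrightarrow> xh"
    using hardcore_F_iterates_tendsto[OF d \<delta> lam] by blast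
  have uniq: "x = xh" if "x \<in> {0..1}" "hardcore_F d lam x = x" for x
    using hardcore_F_fixed_point_unique[OF lam0 _ _ that(2) xh(3)] that(1) xh(2) by simp
  have dxh: "real d * xh < 1"
    using fixed_point_less_inverse_degree[OF d \<delta> lam xh(1) _ xh(3)] xh(2) by simp
  let ?C = "\<lambda>h. linf_SI_constant (tree_verts (Suc d) h)
    (hardcore (tree_verts (Suc d) h) (tree_edges (Suc d) h) lam)"
  let ?L = "\<lambda>n. 1 + real (Suc d) * ((hardcore_F d lam ^^ Suc n) 0 * branch_infl d lam n)"
  \<comment> \<open>The root recursion needs children, so the lower bound is indexed by depth
    \<open>Suc n\<close>; the shift is removed at the end.\<close>
  have lower: "?L n \<le> ?C (Suc n)" for n
  proof -
    interpret hardcore_tree d "Suc n" lam by unfold_locales (rule lam0)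
    have "?L n \<le> total_infl V []" by (rule total_infl_root_ge) simp
    also have "\<dots> \<le> ?C (Suc n)"
      by (rule linf_SI_constant_ge[OF finite_tree_verts]) (simp add: tree_verts_def)
    finally show ?thesis .
  qed
  have upper: "?C h \<le> (1 + xh) / (1 - real d * xh)" for h
  proof -
    interpret hardcore_tree d h lam by unfold_locales (rule lam0)
    show ?thesis
      by (rule linf_SI_constant_le[OF xh(1,2) dxh xh(3) finite_tree_verts card_nbrs_le])
  qed
  have x: "(\<lambda>n. (hardcore_F d lam ^^ Suc n) 0) \<longlonglongrightarrow> xh" using lim by (rule LIMSEQ_Suc)
  \<comment> \<open>The coefficients of the affine recursion tend to \<open>d * xh\<close>, which is
    below 1 by subcriticality.\<close>
  have "branch_infl d lam \<longlonglongrightarrow> 1 / (1 - real d * xh)"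
    by (rule affine_recursion_tendsto[where y = "\<lambda>n. real d * (hardcore_F d lam ^^ Suc n) 0"])
       (use x xh(1) dxh in \<open>auto intro!: tendsto_mult_left simp del: funpow.simps\<close>)
  then have "?L \<longlonglongrightarrow> 1 + real (Suc d) * (xh * (1 / (1 - real d * xh)))"
    using x by (intro tendsto_intros)
  \<comment> \<open>The limit of the lower bounds coincides with the upper bound, which does not
    depend on the depth.\<close>
  also have "1 + real (Suc d) * (xh * (1 / (1 - real d * xh))) = (1 + xh) / (1 - real d * xh)"
    using dxh by (simp add: field_simps)
  finally have "(\<lambda>n. ?C (Suc n)) \<longlonglongrightarrow> (1 + xh) / (1 - real d * xh)"
    by (rule tendsto_sandwich[rotated 2, OF _ tendsto_const]) (use lower upper in auto)
  then have "?C \<longlonglongrightarrow> (1 + xh) / (1 - real d * xh)" by (rule LIMSEQ_imp_Suc)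
  then show ?thesis
    using uniq xh unfolding \<Delta> by (auto intro!: ex1I[of _ xh])
qed

end
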